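(* Every polytope $\mathsf P$ all of whose $2$-faces are either triangles or parallelograms is edge decomposable, and therefore uniquely decomposable. Precisely, if $C_1,\dots,C_r$ are the equivalence classes of the relation $\sim$ on the edges of $\mathsf P$, then $\mathbb{DC}(\mathsf P)$ is a simplicial cone of dimension $r$ whose rays are spanned by (the edge-deformation vectors of) $\mathsf P_{C_1},\dots,\mathsf P_{C_r}$, and $\mathsf P=\mathsf P_{C_1}+\dots+\mathsf P_{C_r}$ is the unique decomposition (up to translation) of $\mathsf P$ into indecomposable polytopes with distinct normal fans.
   Context: The relation $\sim$ is the equivalence relation on the set $E(\mathsf P)$ of edges of $\mathsf P$ generated by $e\sim f$ whenever $e,f$ belong to a common triangular $2$-face, or are opposite edges of a parallelogram $2$-face. A polytope $\mathsf Q$ is a deformation of $\mathsf P$ if $\lambda\mathsf P=\mathsf Q+\mathsf R$ for some $\lambda>0$ and polytope $\mathsf R$. Then for each vertex $p$ of $\mathsf P$ there is an associated vertex $q(p)$ of $\mathsf Q$ (maximized by the same linear functionals), and for every edge $e=pp'$ of $\mathsf P$ there is $\lambda_e\ge0$ with $q(p)-q(p')=\lambda_e(p-p')$. The vector $(\lambda_e)_{e}\in\mathbb R_{\ge0}^{E(\mathsf P)}$ is the edge-deformation vector of $\mathsf Q$; it determines $\mathsf Q$ up to translation. The deformation cone $\mathbb{DC}(\mathsf P)\subset\mathbb R^{E(\mathsf P)}$ is the set of edge-deformation vectors of all deformations of $\mathsf P$. $\mathsf P$ is indecomposable if its only deformations are $\lambda\mathsf P+t$ with $\lambda\ge0$.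 $\mathsf P$ is uniquely decomposable if $\mathbb{DC}(\mathsf P)$ is simplicial. A set $X\subseteq E(\mathsf P)$ is dependent if $\lambda_e=\lambda_f$ for all $e,f\in X$ and all $\lambda\in\mathbb{DC}(\mathsf P)$; it is contractible if the characteristic vector of $E(\mathsf P)\setminus X$ (equivalently, that of $X$) lies in $\mathbb{DC}(\mathsf P)$, and then $\mathsf P_X$ denotes the deformation of $\mathsf P$ (defined up to translation) whose edge-deformation vector is the characteristic vector of $X$. $\mathsf P$ is edge decomposable if $E(\mathsf P)$ can be partitioned into non-empty contractible dependent sets. *)

theory Defs
  imports "HOL-Analysis.Analysis"
    "HOL-Analysis.Finite_Function_Topology"
    "HOL-Library.Disjoint_Sets"
begin

text \<open>
  Minkowski sums are written with the addition of sets from \<^theory>\<open>HOL-Library.Set_Algebras\<close>;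
  in particular the empty sum of sets is \<open>{0}\<close>. Polytopes are understood to be nonempty, which
  has to be said explicitly because \<^const>\<open>polytope\<close> admits the empty set.
\<close>

definition normal_cone :: "'a::euclidean_space set \<Rightarrow> 'a set \<Rightarrow> 'a set" where
  "normal_cone P F = {c. \<forall>x\<in>F. \<forall>y\<in>P. c \<bullet> y \<le> c \<bullet> x}"

definition normal_fan :: "'a::euclidean_space set \<Rightarrow> 'a set set" where
  "normal_fan P = {normal_cone P F |F. F face_of P \<and> F \<noteq> {}}"

definition edges :: "'a::euclidean_space set \<Rightarrow> 'a set set" where
  "edges P = {e. e edge_of P}"

definition parallelogram :: "'a::euclidean_space set \<Rightarrow> bool" where
  "parallelogram F \<longleftrightarrow>
     (\<exists>a u v. \<not> collinear {0, u, v} \<and> F = convex hull {a, a + u, a + v, a + u + v})"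

text \<open>
  Triangles are the sets \<open>F\<close> with \<open>2 simplex F\<close>. Two edges of a parallelogram are opposite
  precisely if they are disjoint.
\<close>

definition edge_step :: "'a::euclidean_space set \<Rightarrow> 'a set \<Rightarrow> 'a set \<Rightarrow> bool" where
  "edge_step P e f \<longleftrightarrow>
     (\<exists>F. F face_of P \<and> aff_dim F = 2 \<and> e edge_of F \<and> f edge_of F \<and>
          (2 simplex F \<or> parallelogram F \<and> e \<inter> f = {}))"

definition edge_equiv :: "'a::euclidean_space set \<Rightarrow> ('a set \<times> 'a set) set" where
  "edge_equiv P = {(e, f). e \<in> edges P \<and> f \<in> edges P \<and> equivclp (edge_step P) e f}"

definition edge_classes :: "'a::euclidean_space set \<Rightarrow> 'a set set set" where
  "edge_classes P = edges P // edge_equiv P"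

definition deformation :: "'a::euclidean_space set \<Rightarrow> 'a set \<Rightarrow> bool" where
  "deformation P Q \<longleftrightarrow> polytope Q \<and> Q \<noteq> {} \<and>
     (\<exists>l>0. \<exists>R. polytope R \<and> R \<noteq> {} \<and> (\<lambda>x. l *\<^sub>R x) ` P = Q + R)"

definition associated_vertices ::
    "'a::euclidean_space set \<Rightarrow> 'a set \<Rightarrow> ('a \<Rightarrow> 'a) \<Rightarrow> bool" where
  "associated_vertices P Q q \<longleftrightarrow>
     (\<forall>p. p extreme_point_of P \<longrightarrow>
        q p extreme_point_of Q \<and> normal_cone P {p} \<subseteq> normal_cone Q {q p})"

text \<open>
  The space of real vectors indexed by the edges of \<open>P\<close> is realised as the space of those
  finitely supported functions on the type of all sets whose support consists of edges of \<open>P\<close>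
  (a polytope has only finitely many edges). This type is a real vector space, so that the notions
  of linear independence, dimension, cones and faces are those of the library.
\<close>

definition edge_deformation_vector ::
    "'a::euclidean_space set \<Rightarrow> 'a set \<Rightarrow> ('a set \<Rightarrow>\<^sub>0 real) \<Rightarrow> bool" where
  "edge_deformation_vector P Q v \<longleftrightarrow>
     Poly_Mapping.keys v \<subseteq> edges P \<and>
     (\<forall>e\<in>edges P. 0 \<le> Poly_Mapping.lookup v e) \<and>
     (\<exists>q. associated_vertices P Q q \<and>
        (\<forall>e\<in>edges P. \<forall>p p'. e = closed_segment p p' \<longrightarrow>
           q p - q p' = Poly_Mapping.lookup v e *\<^sub>R (p - p')))"

definition deformation_cone :: "'a::euclidean_space set \<Rightarrow> ('a set \<Rightarrow>\<^sub>0 real) set" where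
  "deformation_cone P = {v. \<exists>Q. deformation P Q \<and> edge_deformation_vector P Q v}"

definition char_vector :: "'b set \<Rightarrow> ('b \<Rightarrow>\<^sub>0 real)" where
  "char_vector X = (\<Sum>e\<in>X. Poly_Mapping.single e 1)"

definition simplicial_cone :: "'b::real_vector set \<Rightarrow> bool" where
  "simplicial_cone K \<longleftrightarrow> (\<exists>B. finite B \<and> independent B \<and> K = convex_cone hull B)"

definition rays :: "'b::real_vector set \<Rightarrow> 'b set set" where
  "rays K = {F. F face_of K \<and> dim F = 1}"

definition indecomposable :: "'a::euclidean_space set \<Rightarrow> bool" where
  "indecomposable P \<longleftrightarrow> polytope P \<and> P \<noteq> {} \<and>
     (\<forall>Q. deformation P Q \<longrightarrow> (\<exists>l\<ge>0. \<exists>t. Q = (\<lambda>x. l *\<^sub>R x + t) ` P))"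

definition uniquely_decomposable :: "'a::euclidean_space set \<Rightarrow> bool" where
  "uniquely_decomposable P \<longleftrightarrow> simplicial_cone (deformation_cone P)"

definition dependent_edges :: "'a::euclidean_space set \<Rightarrow> 'a set set \<Rightarrow> bool" where
  "dependent_edges P X \<longleftrightarrow> X \<subseteq> edges P \<and>
     (\<forall>v\<in>deformation_cone P. \<forall>e\<in>X. \<forall>f\<in>X. Poly_Mapping.lookup v e = Poly_Mapping.lookup v f)"

definition contractible_edges :: "'a::euclidean_space set \<Rightarrow> 'a set set \<Rightarrow> bool" where
  "contractible_edges P X \<longleftrightarrow> X \<subseteq> edges P \<and> char_vector (edges P - X) \<in> deformation_cone P"

definition edge_decomposable :: "'a::euclidean_space set \<Rightarrow> bool" where
  "edge_decomposable P \<longleftrightarrow>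
     (\<exists>\<X>. partition_on (edges P) \<X> \<and>
          (\<forall>X\<in>\<X>. contractible_edges P X \<and> dependent_edges P X))"

text \<open>
  The polytope \<open>P\<^sub>X\<close> is only defined up to translation, hence it is a relation here:
  \<open>Q\<close> is a representative of \<open>P\<^sub>X\<close>.
\<close>

definition class_deformation :: "'a::euclidean_space set \<Rightarrow> 'a set set \<Rightarrow> 'a set \<Rightarrow> bool" where
  "class_deformation P X Q \<longleftrightarrow> deformation P Q \<and> edge_deformation_vector P Q (char_vector X)"

text \<open>
  The family \<open>(Q i)\<close>, \<open>i \<in> I\<close>, is a decomposition of \<open>P\<close>, up to translation, into indecomposable
  polytopes with distinct normal fans. Points are indecomposable, but as summands they only
  translate, so they are not admitted as members of a decomposition.
\<close>

definition indecomposable_decomposition ::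
    "'a::euclidean_space set \<Rightarrow> 'i set \<Rightarrow> ('i \<Rightarrow> 'a set) \<Rightarrow> bool" where
  "indecomposable_decomposition P I Q \<longleftrightarrow>
     finite I \<and>
     (\<forall>i\<in>I. indecomposable (Q i) \<and> \<not> (\<exists>x. Q i = {x})) \<and>
     inj_on (\<lambda>i. normal_fan (Q i)) I \<and>
     (\<exists>t. P = (+) t ` (\<Sum>i\<in>I. Q i))"

end

theory Submission
  imports Defs
begin

text \<open>
  An edge-deformation vector is a potential on the vertices: the vertices \<open>q p\<close> of a deformation
  satisfy \<open>q p - q p' = \<lambda>\<^sub>e (p - p')\<close> along the edges \<open>e = pp'\<close>, and conversely, by Shephard, any such
  \<open>q\<close> with \<open>\<lambda> \<ge> 0\<close> is the vertex map of the deformation \<open>conv {q p}\<close>. Around a triangle the closing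
  condition forces equal values of \<open>\<lambda>\<close>, around a parallelogram equal values on opposite edges, so \<open>\<lambda>\<close>
  is constant on the classes of \<open>\<sim>\<close>. Conversely, for \<open>\<lambda>\<close> constant on the classes the potential exists
  around every \<open>2\<close>-face, hence globally: it is built vertex by vertex from the top of a generic linear
  functional, and is consistent because the upper edges at a vertex are connected through
  \<open>2\<close>-faces. So the deformation cone consists of the nonnegative vectors constant on the classes;
  decomposing \<open>P\<close> amounts to decomposing the all-ones vector into vectors on the rays of this cone.
\<close>

section \<open>Edge paths on polytopes\<close>

text \<open>Shephard's criterion, uniqueness up to translation and connectedness of the upper edges
  all rest on one induction: a vertex that does not maximize a functional has a better neighbour, so
  everything propagates down from a unique maximum. Where the maximum is not unique, a small
  multiple of a functional exposing one chosen vertex is added. Connectedness of the upper edges is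
  proved in the vertex figure at \<open>p\<close>: its vertices represent the edges at
  \<open>p\<close>, its edges come from 2-faces.

  Uniqueness of the decomposition concerns arbitrary indecomposable summands \<open>R\<close>, whose
  own faces are unknown. The vector of \<open>R\<close> is therefore taken with respect to
  \<open>P\<close>. If a class \<open>C\<close> has a positive coefficient in it, a multiple of the
  polytope of \<open>C\<close> is a summand of \<open>R\<close>, hence homothetic to
  \<open>R\<close>. Distinct normal fans prevent a class from occurring twice, and comparison with
  the all-ones vector leaves every class with coefficient 1.\<close>

abbreviation adjacent :: "'a::euclidean_space set \<Rightarrow> 'a \<Rightarrow> 'a \<Rightarrow> bool" where
  "adjacent P p p' \<equiv> closed_segment p p' edge_of P"

lemma adjacent_sym: "adjacent P p p' \<Longrightarrow> adjacent P p' p"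
  by (simp add: closed_segment_commute)

lemma adjacent_neq: "adjacent P p p' \<Longrightarrow> p \<noteq> p'"
  by (auto simp: edge_of_def)

lemma adjacent_extreme:
  assumes "adjacent P p p'"
  shows "p extreme_point_of P" "p' extreme_point_of P"
  using assms segment_face_of unfolding edge_of_def by blast+

lemma polytope_edge_obtain:
  fixes P :: "'a::euclidean_space set"
  assumes "polytope P" "e edge_of P"
  obtains p p' where "p \<noteq> p'" "p extreme_point_of P" "p' extreme_point_of P" "e = closed_segment p p'"
proof -
  have e: "e face_of P" "aff_dim e = 1" using assms(2) by (auto simp: edge_of_def)
  then have "polytope e" using assms(1) face_of_polytope_polytope by blast
  moreover have "e \<noteq> {}" using e by auto
  moreover have "collinear e" using e by (simp add: collinear_aff_dim)
  ultimately obtain p p' where pp: "e = closed_segment p p'"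
    using compact_convex_collinear_segment polytope_imp_compact polytope_imp_convex by metis
  then have "p \<noteq> p'" using e by auto
  with pp e that segment_face_of show ?thesis by metis
qed

section \<open>Extreme points and faces of polytopes\<close>

lemma polytope_extreme_finite:
  fixes P :: "'a::euclidean_space set"
  shows "polytope P \<Longrightarrow> finite {v. v extreme_point_of P}"
  using finite_polyhedron_extreme_points polytope_imp_polyhedron by blast

lemma polytope_hull_extreme:
  fixes P :: "'a::euclidean_space set"
  shows "polytope P \<Longrightarrow> P = convex hull {v. v extreme_point_of P}"
  using Krein_Milman_Minkowski polytope_imp_compact polytope_imp_convex by blast

lemma polytope_extreme_exists:
  fixes P :: "'a::euclidean_space set"
  shows "polytope P \<Longrightarrow> P \<noteq> {} \<Longrightarrow> \<exists>v. v extreme_point_of P"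
  using extreme_point_exists_convex polytope_imp_compact polytope_imp_convex by metis

lemma polytope_le_extreme:
  fixes P :: "'a::euclidean_space set"
  assumes "polytope P" "\<And>v. v extreme_point_of P \<Longrightarrow> c \<bullet> v \<le> b" "x \<in> P"
  shows "c \<bullet> x \<le> b"
proof -
  have "convex hull {v. v extreme_point_of P} \<subseteq> {x. c \<bullet> x \<le> b}"
    using assms by (intro hull_minimal) (auto simp: convex_halfspace_le)
  then show ?thesis using polytope_hull_extreme[OF assms(1)] assms(3) by auto
qed

lemma polytope_extreme_maximum:
  fixes P :: "'a::euclidean_space set"
  assumes "polytope P" "P \<noteq> {}"
  obtains v where "v extreme_point_of P" "\<And>x. x \<in> P \<Longrightarrow> c \<bullet> x \<le> c \<bullet> v"
proof -
  let ?S = "{v. v extreme_point_of P}"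
  have fin: "finite ((\<bullet>) c ` ?S)" and ne: "(\<bullet>) c ` ?S \<noteq> {}"
    using polytope_extreme_finite polytope_extreme_exists assms by auto
  obtain v where v: "v \<in> ?S" "c \<bullet> v = Max ((\<bullet>) c ` ?S)"
    using Max_in[OF fin ne] by (metis (no_types, lifting) imageE)
  then have "c \<bullet> w \<le> c \<bullet> v" if "w extreme_point_of P" for w
    using that fin by auto
  then show ?thesis using v that polytope_le_extreme[OF assms(1)] by blast
qed

lemma polytope_extreme_exposed:
  fixes P :: "'a::euclidean_space set"
  assumes "polytope P" "p extreme_point_of P"
  obtains a where "\<And>x. x \<in> P \<Longrightarrow> x \<noteq> p \<Longrightarrow> a \<bullet> x < a \<bullet> p"
proof -
  have "{p} exposed_face_of P"
    using assms by (simp add: exposed_face_of_polyhedron face_of_singleton polytope_imp_polyhedron)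
  then obtain a b where ab: "P \<subseteq> {x. a \<bullet> x \<le> b}" "{p} = P \<inter> {x. a \<bullet> x = b}"
    unfolding exposed_face_of_def by metis
  have "a \<bullet> x < a \<bullet> p" if "x \<in> P" "x \<noteq> p" for x
  proof -
    have "a \<bullet> p = b" using ab(2) by blast
    moreover have "a \<bullet> x \<le> b" "a \<bullet> x \<noteq> b" using that ab by blast+
    ultimately show ?thesis by simp
  qed
  with that show thesis by metis
qed

text \<open>The smallest face containing \<open>z\<close> works: a relative boundary point would lie
  in a facet of it, which is a still smaller face of \<open>P\<close>.\<close>

lemma polytope_rel_interior_face:
  fixes P :: "'a::euclidean_space set"
  assumes "polytope P" "z \<in> P"
  obtains F where "F face_of P" "z \<in> rel_interior F"
proof -
  let ?X = "{F. F face_of P \<and> z \<in> F}"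
  define F where "F = \<Inter>?X"
  have "P \<in> ?X" using assms by (simp add: face_of_refl polytope_imp_convex)
  then have F: "F face_of P" "z \<in> F" unfolding F_def by (blast intro: face_of_Inter)+
  have "polyhedron F" using F assms face_of_polyhedron_polyhedron polytope_imp_polyhedron by blast
  have "z \<in> rel_interior F"
  proof (rule ccontr)
    assume "z \<notin> rel_interior F"
    then have "z \<in> \<Union>{G. G facet_of F}"
      using rel_boundary_of_polyhedron[OF \<open>polyhedron F\<close>] F by blast
    then obtain G where G: "G facet_of F" "z \<in> G" by blast
    then have "G face_of P" using F facet_of_imp_face_of face_of_trans by blast
    then have "F \<subseteq> G" using G unfolding F_def by blast
    then have "G = F" using G facet_of_imp_subset by blast
    with G show False by simp
  qed
  with F that show ?thesis by blast
qed

text \<open>\<open>F\<close> is the face with a relative interior point \<open>z\<close> of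
  \<open>G\<close> in its relative interior. The section of \<open>F\<close> then has
  \<open>z\<close> in its relative interior too, so it equals \<open>G\<close>. The dimension drops
  by exactly one because the vertices of \<open>F\<close> avoid the hyperplane.\<close>

lemma face_of_hyperplane_section:
  fixes P :: "'a::euclidean_space set"
  assumes "polytope P" and noextr: "\<And>v. v extreme_point_of P \<Longrightarrow> a \<bullet> v \<noteq> \<beta>"
    and G: "G face_of (P \<inter> {x. a \<bullet> x = \<beta>})" "G \<noteq> {}"
  obtains F where "F face_of P" "G = F \<inter> {x. a \<bullet> x = \<beta>}" "aff_dim F = aff_dim G + 1"
proof -
  define H where "H = {x. a \<bullet> x = \<beta>}"
  have affH: "affine H" unfolding H_def by (simp add: affine_hyperplane)
  have "convex G" using G(1) face_of_imp_convex by blast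
  then obtain z where z: "z \<in> rel_interior G" using G(2) rel_interior_eq_empty by blast
  have zH: "z \<in> P" "z \<in> H"
    using z rel_interior_subset face_of_imp_subset[OF G(1)] unfolding H_def by blast+
  obtain F where F: "F face_of P" "z \<in> rel_interior F"
    using polytope_rel_interior_face assms(1) zH by metis
  have convF: "convex F" using F face_of_imp_convex by blast
  have FH: "(F \<inter> H) face_of (P \<inter> H)"
    using F(1) affH by (intro face_of_slice) (auto intro: affine_imp_convex)
  have "rel_interior (F \<inter> H) = rel_interior F \<inter> H"
    using convex_affine_rel_interior_Int[OF convF affH] F zH by blast
  then have "z \<in> rel_interior (F \<inter> H)" using F zH by blast
  then have GF: "G = F \<inter> H"
    using face_of_eq[OF G(1)] FH z unfolding H_def by blast
  \<comment> \<open>The relative interior of \<open>F\<close> is open in its affine hull, so a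
    nonempty relatively open part of \<open>?S\<close> lies in \<open>F \<inter> H\<close>. Hence
    \<open>F \<inter> H\<close> spans all of \<open>?S\<close>.\<close>
  obtain O' where O': "open O'" "rel_interior F = affine hull F \<inter> O'"
    using openin_rel_interior[of F] unfolding openin_open by blast
  let ?S = "affine hull F \<inter> H"
  have affS: "affine ?S" using affH by (simp add: affine_Int)
  have "?S \<inter> O' \<noteq> {}" using F(2) O' zH by blast
  then have "affine hull (?S \<inter> O') = ?S"
    using affine_hull_affine_Int_open[OF affS O'(1)] hull_same[of affine ?S] affS by simp
  moreover have "?S \<inter> O' \<subseteq> F \<inter> H" using O' rel_interior_subset by blast
  moreover have "affine hull (F \<inter> H) \<subseteq> ?S"
    using affS by (intro hull_minimal) (auto simp: hull_inc)
  ultimately have eq: "affine hull (F \<inter> H) = ?S"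
    by (metis hull_mono subset_antisym)
  have "polytope F" "F \<noteq> {}"
    using F assms(1) face_of_polytope_polytope rel_interior_empty by blast+
  then obtain v where "v extreme_point_of F" using polytope_extreme_exists by blast
  then have "v extreme_point_of P" "v \<in> F"
    using F(1) extreme_point_of_face extreme_point_of_def by blast+
  then have "\<not> affine hull F \<subseteq> H" using noextr[of v] hull_inc[of v F affine] unfolding H_def by auto
  moreover have "?S \<noteq> {}" using F(2) zH(2) rel_interior_subset[of F] hull_subset[of F affine] by blast
  ultimately have "aff_dim ?S = aff_dim F - 1"
    using aff_dim_affine_Int_hyperplane[of "affine hull F" a \<beta>] unfolding H_def by auto
  then have "aff_dim F = aff_dim G + 1" using eq GF by (metis aff_dim_affine_hull diff_add_cancel)
  with F GF that show ?thesis unfolding H_def by blast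
qed

lemma segment_crosses_level:
  fixes a p y :: "'a::euclidean_space"
  assumes "a \<bullet> y < \<beta>" "\<beta> < a \<bullet> p"
  obtains t where "0 < t" "t < 1" "\<And>u. a \<bullet> ((1 - u) *\<^sub>R p + u *\<^sub>R y) = \<beta> \<longleftrightarrow> u = t"
proof -
  have eq: "a \<bullet> ((1 - u) *\<^sub>R p + u *\<^sub>R y) = a \<bullet> p - u * (a \<bullet> p - a \<bullet> y)" for u
    by (simp only: inner_add_right inner_scaleR_right) (simp add: algebra_simps)
  have "a \<bullet> ((1 - u) *\<^sub>R p + u *\<^sub>R y) = \<beta> \<longleftrightarrow> u = (a \<bullet> p - \<beta>) / (a \<bullet> p - a \<bullet> y)" for u
    unfolding eq using assms by (auto simp: field_simps)
  moreover have "0 < (a \<bullet> p - \<beta>) / (a \<bullet> p - a \<bullet> y)" "(a \<bullet> p - \<beta>) / (a \<bullet> p - a \<bullet> y) < 1"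
    using assms by (auto simp: field_simps)
  ultimately show ?thesis using that by blast
qed

text \<open>
  The hyperplane \<open>a \<bullet> x = \<beta>\<close> separates the vertex \<open>p\<close> from all others, so it meets
  \<open>P\<close> in a vertex figure of \<open>P\<close> at \<open>p\<close>.
\<close>

locale vertex_figure =
  fixes P :: "'a::euclidean_space set" and p a :: 'a and \<beta> :: real
  assumes polytope: "polytope P"
    and p: "p extreme_point_of P" "\<beta> < a \<bullet> p"
    and others: "v extreme_point_of P \<Longrightarrow> v \<noteq> p \<Longrightarrow> a \<bullet> v < \<beta>"
begin

definition "figure = P \<inter> {x. a \<bullet> x = \<beta>}"

lemma polytope_figure: "polytope figure"
  unfolding figure_def
  by (intro polytope_Int_polyhedron polytope polyhedron_hyperplane)

lemma off_hyperplane: "v extreme_point_of P \<Longrightarrow> a \<bullet> v \<noteq> \<beta>"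
  using others[of v] p(2) by (cases "v = p") auto

text \<open>A vertex of the figure is the section of an edge of \<open>P\<close>. One end of this
  edge has to be \<open>p\<close>, since otherwise both ends, and with them the whole edge, lie
  strictly below the level \<open>\<beta>\<close>.\<close>

lemma figure_extreme:
  assumes "v extreme_point_of figure"
  obtains p' where "adjacent P p p'" "v \<in> open_segment p p'"
proof -
  have v: "v \<in> P" "a \<bullet> v = \<beta>" using assms unfolding extreme_point_of_def figure_def by auto
  have "{v} face_of (P \<inter> {x. a \<bullet> x = \<beta>})" using assms unfolding figure_def face_of_singleton .
  then obtain F where F: "F face_of P" "{v} = F \<inter> {x. a \<bullet> x = \<beta>}" "aff_dim F = aff_dim {v} + 1"
    using face_of_hyperplane_section[OF polytope off_hyperplane, of "{v}"] by blast
  have "F edge_of P" using F(1,3) by (simp add: edge_of_def)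
  then obtain x y where xy: "x \<noteq> y" "x extreme_point_of P" "y extreme_point_of P" "F = closed_segment x y"
    using polytope_edge_obtain[OF polytope] by metis
  have "v \<noteq> x" "v \<noteq> y" using xy v off_hyperplane by blast+
  then have vo: "v \<in> open_segment x y" using F xy by (auto simp: open_segment_def)
  then obtain u where u: "0 < u" "u < 1" "v = (1 - u) *\<^sub>R x + u *\<^sub>R y" by (auto simp: in_segment)
  have "x = p \<or> y = p"
  proof (rule ccontr)
    assume "\<not> (x = p \<or> y = p)"
    then have "a \<bullet> x < \<beta>" "a \<bullet> y < \<beta>" using others xy by auto
    then have "(1 - u) * (a \<bullet> x) < (1 - u) * \<beta>" "u * (a \<bullet> y) < u * \<beta>" using u by auto
    moreover have "a \<bullet> v = (1 - u) * (a \<bullet> x) + u * (a \<bullet> y)" by (simp add: u inner_add_right)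
    ultimately show False using v by (simp add: algebra_simps)
  qed
  then show ?thesis
    using that[of y] that[of x] vo xy \<open>F edge_of P\<close>
    by (auto simp: closed_segment_commute open_segment_commute)
qed

text \<open>Conversely, the ends of an edge at \<open>p\<close> lie on different sides of the
  hyperplane, so its section, which is a face of the figure, is a single point.\<close>

lemma extreme_figure_of_adjacent:
  assumes "adjacent P p p'"
  obtains v where "v extreme_point_of figure" "v \<in> open_segment p p'"
proof -
  have p': "p' extreme_point_of P" "p' \<noteq> p"
    using assms adjacent_extreme adjacent_neq by blast+
  then have lt: "a \<bullet> p' < \<beta>" "\<beta> < a \<bullet> p" using others p by blast+
  obtain t where t: "0 < t" "t < 1"
    and inn: "\<And>u. a \<bullet> ((1 - u) *\<^sub>R p + u *\<^sub>R p') = \<beta> \<longleftrightarrow> u = t"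
    using segment_crosses_level lt by blast
  define v where "v = (1 - t) *\<^sub>R p + t *\<^sub>R p'"
  have vo: "v \<in> open_segment p p'" using p' t unfolding v_def in_segment by auto
  have "closed_segment p p' \<inter> {x. a \<bullet> x = \<beta>} = {v}"
  proof
    show "closed_segment p p' \<inter> {x. a \<bullet> x = \<beta>} \<subseteq> {v}"
    proof
      fix x assume "x \<in> closed_segment p p' \<inter> {x. a \<bullet> x = \<beta>}"
      then obtain u where "x = (1 - u) *\<^sub>R p + u *\<^sub>R p'" "a \<bullet> x = \<beta>" by (auto simp: in_segment)
      then show "x \<in> {v}" using inn[of u] unfolding v_def by simp
    qed
    show "{v} \<subseteq> closed_segment p p' \<inter> {x. a \<bullet> x = \<beta>}"
      using inn[of t] vo unfolding v_def[symmetric] by (auto simp: open_segment_def)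
  qed
  moreover have "closed_segment p p' \<inter> {x. a \<bullet> x = \<beta>} face_of figure"
    unfolding figure_def using assms
    by (intro face_of_slice) (auto simp: edge_of_def convex_hyperplane)
  ultimately show ?thesis using that vo face_of_singleton by metis
qed

text \<open>The edge to \<open>p2\<close> is a face containing the inner point \<open>v\<close> of
  the segment to \<open>p1\<close>, so it contains the vertex \<open>p1\<close> as well.\<close>

lemma figure_extreme_unique:
  assumes "adjacent P p p1" "adjacent P p p2" "v \<in> open_segment p p1" "v \<in> open_segment p p2"
  shows "p1 = p2"
proof -
  have F: "closed_segment p p2 face_of P" using assms edge_of_def by blast
  have e: "p1 extreme_point_of P" "p1 \<noteq> p" using assms(1) adjacent_extreme adjacent_neq by blast+
  have "v \<in> closed_segment p p2" using assms(4) by (auto simp: open_segment_def)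
  then have "p1 \<in> closed_segment p p2"
    using face_ofD[OF F assms(3)] e p unfolding extreme_point_of_def by blast
  then have "p1 extreme_point_of closed_segment p p2" using extreme_point_of_face[OF F] e by blast
  then show ?thesis using e by (simp add: extreme_point_of_segment)
qed

end

lemma vertex_figure_exists:
  fixes P :: "'a::euclidean_space set"
  assumes "polytope P" "p extreme_point_of P"
  obtains a \<beta> where "vertex_figure P p a \<beta>"
proof -
  obtain a where a: "\<And>x. x \<in> P \<Longrightarrow> x \<noteq> p \<Longrightarrow> a \<bullet> x < a \<bullet> p"
    using polytope_extreme_exposed assms by metis
  let ?S = "(\<bullet>) a ` ({v. v extreme_point_of P} - {p})"
  have fin: "finite ?S" using polytope_extreme_finite assms by auto
  have lt: "\<forall>s\<in>?S. s < a \<bullet> p" using a by (auto simp: extreme_point_of_def)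
  \<comment> \<open>If \<open>p\<close> is the only vertex, there is no maximum over the others to
    take, and any number below \<open>a \<bullet> p\<close> serves.\<close>
  obtain m where m: "m < a \<bullet> p" "\<forall>s\<in>?S. s \<le> m"
  proof (cases "?S = {}")
    case True then show ?thesis using that[of "a \<bullet> p - 1"] by auto
  next
    case False
    then show ?thesis using that[of "Max ?S"] fin lt Max_in[OF fin False] Max_ge[OF fin] by blast
  qed
  obtain \<beta> where "m < \<beta>" "\<beta> < a \<bullet> p" using m(1) dense by blast
  with m have "vertex_figure P p a \<beta>"
    using assms by unfold_locales force+
  then show ?thesis using that by blast
qed

section \<open>Monotone edge paths\<close>

lemma inner_open_segment_pos:
  fixes c p q :: "'a::euclidean_space"
  assumes "v \<in> open_segment p q"
  shows "c \<bullet> p < c \<bullet> v \<longleftrightarrow> c \<bullet> p < c \<bullet> q"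
proof -
  obtain u where u: "0 < u" "v = (1 - u) *\<^sub>R p + u *\<^sub>R q" using assms by (auto simp: in_segment)
  then have "c \<bullet> v - c \<bullet> p = u * (c \<bullet> q - c \<bullet> p)"
    unfolding u(2) inner_add_right inner_scaleR_right by (simp add: algebra_simps)
  then have "0 < c \<bullet> v - c \<bullet> p \<longleftrightarrow> 0 < c \<bullet> q - c \<bullet> p"
    using u(1) by (simp add: zero_less_mult_iff)
  then show ?thesis by simp
qed

text \<open>The segment from \<open>p\<close> to a better vertex crosses the vertex figure in a
  point that is better than \<open>p\<close>. So some vertex of the figure is better than
  \<open>p\<close>, and the edge on which it lies leads upwards.\<close>

lemma improving_neighbour:
  fixes P :: "'a::euclidean_space set"
  assumes "polytope P" "p extreme_point_of P" "x \<in> P" "c \<bullet> p < c \<bullet> x"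
  obtains p' where "adjacent P p p'" "c \<bullet> p < c \<bullet> p'"
proof -
  obtain a \<beta> where "vertex_figure P p a \<beta>" using vertex_figure_exists assms by blast
  then interpret vertex_figure P p a \<beta> .
  obtain y where y: "y extreme_point_of P" "c \<bullet> p < c \<bullet> y"
    using polytope_le_extreme[OF assms(1), of c "c \<bullet> p" x] assms by force
  then have lt: "a \<bullet> y < \<beta>" "\<beta> < a \<bullet> p" using others p by auto
  obtain t where t: "0 < t" "t < 1"
    and inn: "\<And>u. a \<bullet> ((1 - u) *\<^sub>R p + u *\<^sub>R y) = \<beta> \<longleftrightarrow> u = t"
    using segment_crosses_level lt by blast
  define v where "v = (1 - t) *\<^sub>R p + t *\<^sub>R y"
  have "a \<bullet> v = \<beta>" using inn v_def by blast
  moreover have vo: "v \<in> open_segment p y" using y t unfolding v_def in_segment by auto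
  moreover have "v \<in> P"
    using t p y assms(1) polytope_imp_convex unfolding v_def extreme_point_of_def
    by (intro convexD) auto
  ultimately have "v \<in> figure" unfolding figure_def by auto
  moreover have "c \<bullet> p < c \<bullet> v" using vo y inner_open_segment_pos by blast
  ultimately obtain w where w: "w extreme_point_of figure" "c \<bullet> p < c \<bullet> w"
    using polytope_le_extreme[OF polytope_figure, of c "c \<bullet> p" v] by force
  then obtain p' where "adjacent P p p'" "w \<in> open_segment p p'" using figure_extreme by blast
  with w that show ?thesis using inner_open_segment_pos by blast
qed

text \<open>Induction along a \<open>d\<close>-increasing edge path from \<open>w\<close> to
  \<open>p\<close>. Each step to a better neighbour lowers the number of vertices above the current
  one, and only \<open>p\<close> admits no step.\<close>

lemma monotone_path_induct [consumes 3, case_names unique_max top step]: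
  fixes P :: "'a::euclidean_space set"
  assumes "polytope P" "w extreme_point_of P" "p \<in> P"
    and max: "\<And>x. x \<in> P \<Longrightarrow> x \<noteq> p \<Longrightarrow> d \<bullet> x < d \<bullet> p"
    and top: "\<Phi> p"
    and step: "\<And>w w'. adjacent P w w' \<Longrightarrow> d \<bullet> w < d \<bullet> w' \<Longrightarrow> \<Phi> w' \<Longrightarrow> \<Phi> w"
  shows "\<Phi> w"
  using assms(2)
proof (induction "card {v. v extreme_point_of P \<and> d \<bullet> w < d \<bullet> v}" arbitrary: w rule: less_induct)
  case less
  show ?case
  proof (cases "w = p")
    case True then show ?thesis using top by simp
  next
    case False
    then have "d \<bullet> w < d \<bullet> p" using max less.prems by (auto simp: extreme_point_of_def)
    then obtain w' where w': "adjacent P w w'" "d \<bullet> w < d \<bullet> w'"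
      using improving_neighbour assms(1,3) less.prems by metis
    then have e: "w' extreme_point_of P" using adjacent_extreme by blast
    have "{v. v extreme_point_of P \<and> d \<bullet> w' < d \<bullet> v} \<subset> {v. v extreme_point_of P \<and> d \<bullet> w < d \<bullet> v}"
      using w' e by force
    then have "card {v. v extreme_point_of P \<and> d \<bullet> w' < d \<bullet> v} < card {v. v extreme_point_of P \<and> d \<bullet> w < d \<bullet> v}"
      using polytope_extreme_finite[OF assms(1)] by (intro psubset_card_mono) auto
    then show ?thesis using less.hyps e w' step by blast
  qed
qed

text \<open>Used to add a small multiple of a second functional without destroying finitely many
  strict inequalities.\<close>

lemma small_perturbation:
  fixes g h :: "'b \<Rightarrow> real"
  assumes "finite W" "\<And>w. w \<in> W \<Longrightarrow> 0 < g w"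
  obtains \<epsilon> where "0 < \<epsilon>" "\<And>w. w \<in> W \<Longrightarrow> \<epsilon> * h w < g w"
proof -
  have "\<forall>\<^sub>F \<epsilon> in at_right 0. \<epsilon> * h w < g w" if "w \<in> W" for w
  proof -
    have "((\<lambda>\<epsilon>. \<epsilon> * h w) \<longlongrightarrow> 0 * h w) (at_right 0)" by (intro tendsto_intros)
    then show ?thesis using assms(2)[OF that] by (auto dest: order_tendstoD)
  qed
  then have "\<forall>\<^sub>F \<epsilon> in at_right 0. \<forall>w\<in>W. \<epsilon> * h w < g w"
    using assms(1) by (simp add: eventually_ball_finite)
  moreover have "\<forall>\<^sub>F \<epsilon> in at_right 0. (0::real) < \<epsilon>" by (simp add: eventually_at_right_less)
  ultimately have "\<forall>\<^sub>F \<epsilon> in at_right 0. (0::real) < \<epsilon> \<and> (\<forall>w\<in>W. \<epsilon> * h w < g w)"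
    using eventually_conj by blast
  then obtain \<epsilon> where "(0::real) < \<epsilon> \<and> (\<forall>w\<in>W. \<epsilon> * h w < g w)"
    using eventually_happens'[OF trivial_limit_at_right_real] by blast
  then show ?thesis using that by blast
qed

text \<open>
  In the vertex figure, any two points above a level of \<open>c\<close> are joined through points above
  that level: follow increasing paths of a slight perturbation of \<open>c\<close> that has a unique maximum.
  The edges of the vertex figure are sections of \<open>2\<close>-faces of \<open>P\<close>.
\<close>

lemma upper_neighbours_connected:
  fixes P :: "'a::euclidean_space set"
  assumes "polytope P" "adjacent P p p1" "adjacent P p p2" "c \<bullet> p < c \<bullet> p1" "c \<bullet> p < c \<bullet> p2"
    and cong: "\<And>F x y. F face_of P \<Longrightarrow> aff_dim F = 2 \<Longrightarrow> adjacent P p x \<Longrightarrow> adjacent P p y \<Longrightarrow>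
        closed_segment p x \<subseteq> F \<Longrightarrow> closed_segment p y \<subseteq> F \<Longrightarrow> c \<bullet> p < c \<bullet> x \<Longrightarrow> c \<bullet> p < c \<bullet> y \<Longrightarrow>
        f x = f y"
  shows "f p1 = f p2"
proof -
  have pe: "p extreme_point_of P" using adjacent_extreme assms(2) by blast
  then obtain a \<beta> where "vertex_figure P p a \<beta>" using vertex_figure_exists assms(1) by blast
  then interpret vertex_figure P p a \<beta> .
  obtain v1 where v1: "v1 extreme_point_of figure" "v1 \<in> open_segment p p1"
    using extreme_figure_of_adjacent assms(2) by blast
  obtain v2 where v2: "v2 extreme_point_of figure" "v2 \<in> open_segment p p2"
    using extreme_figure_of_adjacent assms(3) by blast
  \<comment> \<open>\<open>n v\<close> is the neighbour of \<open>p\<close> whose edge passes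
    through the figure vertex \<open>v\<close>.\<close>
  have "\<exists>n. \<forall>v. v extreme_point_of figure \<longrightarrow> adjacent P p (n v) \<and> v \<in> open_segment p (n v)"
    by (intro choice allI) (metis figure_extreme)
  then obtain n where n: "\<And>v. v extreme_point_of figure \<Longrightarrow> adjacent P p (n v)"
    "\<And>v. v extreme_point_of figure \<Longrightarrow> v \<in> open_segment p (n v)" by metis
  have n12: "n v1 = p1" "n v2 = p2"
    using figure_extreme_unique[of "n v1" p1] figure_extreme_unique[of "n v2" p2] n v1 v2 assms by blast+
  have "figure \<noteq> {}" using v1 extreme_point_of_def by blast
  then obtain m where m: "m extreme_point_of figure" "\<And>x. x \<in> figure \<Longrightarrow> c \<bullet> x \<le> c \<bullet> m"
    using polytope_extreme_maximum[OF polytope_figure] by metis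
  \<comment> \<open>\<open>m\<close> maximizes \<open>c\<close> on the figure, perhaps not alone;
    \<open>b\<close> breaks ties in favour of \<open>m\<close>.\<close>
  obtain b where b: "\<And>x. x \<in> figure \<Longrightarrow> x \<noteq> m \<Longrightarrow> b \<bullet> x < b \<bullet> m"
    using polytope_extreme_exposed[OF polytope_figure m(1)] by metis
  let ?W = "{w. w extreme_point_of figure \<and> c \<bullet> p < c \<bullet> w}"
  have "finite ?W" using polytope_extreme_finite[OF polytope_figure] by auto
  then obtain \<epsilon> where eps: "0 < \<epsilon>" "\<And>w. w \<in> ?W \<Longrightarrow> \<epsilon> * (b \<bullet> m - b \<bullet> w) < c \<bullet> w - c \<bullet> p"
    using small_perturbation[of ?W "\<lambda>w. c \<bullet> w - c \<bullet> p" "\<lambda>w. b \<bullet> m - b \<bullet> w"] by auto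
  define d where "d = c + \<epsilon> *\<^sub>R b"
  have dx: "d \<bullet> x = c \<bullet> x + \<epsilon> * (b \<bullet> x)" for x by (simp add: d_def inner_add_left)
  \<comment> \<open>The level for \<open>d\<close> is raised by the largest value of
    \<open>\<epsilon> *\<^sub>R b\<close> on the figure. Thus being above it for \<open>d\<close>
    implies being above \<open>c \<bullet> p\<close> for \<open>c\<close>; at vertices of the figure
    the converse is the choice of \<open>\<epsilon>\<close>.\<close>
  let ?\<gamma> = "c \<bullet> p + \<epsilon> * (b \<bullet> m)"
  have up: "c \<bullet> p < c \<bullet> w \<longleftrightarrow> ?\<gamma> < d \<bullet> w" if "w extreme_point_of figure" for w
  proof
    assume "c \<bullet> p < c \<bullet> w"
    then have "\<epsilon> * (b \<bullet> m - b \<bullet> w) < c \<bullet> w - c \<bullet> p" using eps that by blast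
    then show "?\<gamma> < d \<bullet> w" by (simp add: dx algebra_simps)
  next
    assume *: "?\<gamma> < d \<bullet> w"
    have "b \<bullet> w \<le> b \<bullet> m" using b[of w] that by (cases "w = m") (auto simp: extreme_point_of_def)
    then have "\<epsilon> * (b \<bullet> w) \<le> \<epsilon> * (b \<bullet> m)" using eps by auto
    with * show "c \<bullet> p < c \<bullet> w" by (simp add: dx)
  qed
  have mf: "m \<in> figure" using m extreme_point_of_def by blast
  have main: "?\<gamma> < d \<bullet> w \<longrightarrow> f (n w) = f (n m)" if "w extreme_point_of figure" for w
    using polytope_figure that mf
  proof (induction rule: monotone_path_induct[where d = d])
    case (unique_max x)
    then have "\<epsilon> * (b \<bullet> x) < \<epsilon> * (b \<bullet> m)" using b eps by simp
    then show ?case using m(2)[OF unique_max(1)] by (simp add: dx)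
  next
    case (step w w')
    show ?case
    proof
      assume w: "?\<gamma> < d \<bullet> w"
      then have w': "?\<gamma> < d \<bullet> w'" using step by simp
      have e: "w extreme_point_of figure" "w' extreme_point_of figure"
        using step adjacent_extreme by blast+
      have G: "closed_segment w w' face_of P \<inter> {x. a \<bullet> x = \<beta>}" "aff_dim (closed_segment w w') = 1"
        using step unfolding edge_of_def figure_def by auto
      obtain F where F: "F face_of P" "closed_segment w w' = F \<inter> {x. a \<bullet> x = \<beta>}"
          "aff_dim F = aff_dim (closed_segment w w') + 1"
        using face_of_hyperplane_section[OF polytope off_hyperplane G(1)] by auto
      \<comment> \<open>A face that contains the inner point \<open>v\<close> of an edge contains
        both of its ends.\<close>
      have sub: "closed_segment p (n v) \<subseteq> F" if "v extreme_point_of figure" "v \<in> F" for v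
      proof -
        have "n v \<in> P" "p \<in> P" using adjacent_extreme[OF n(1)[OF that(1)]] extreme_point_of_def by blast+
        then have "p \<in> F" "n v \<in> F" using face_ofD[OF F(1) n(2)[OF that(1)]] that by blast+
        then show ?thesis using F face_of_imp_convex closed_segment_subset by blast
      qed
      have "w \<in> F" "w' \<in> F" using F(2) by auto
      then have "f (n w) = f (n w')"
        using cong[of F "n w" "n w'"] F G sub e n w w' up inner_open_segment_pos by force
      then show "f (n w) = f (n m)" using step w' by simp
    qed
  qed simp
  have "?\<gamma> < d \<bullet> v1" "?\<gamma> < d \<bullet> v2"
    using up v1 v2 inner_open_segment_pos assms(4,5) by blast+
  then show ?thesis using main v1 v2 n12 by metis
qed

section \<open>Triangles and parallelograms\<close>

lemma edge_of_face:
  assumes "F face_of P"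
  shows "e edge_of F \<longleftrightarrow> e edge_of P \<and> e \<subseteq> F"
  using face_of_face[OF assms] by (auto simp: edge_of_def)

text \<open>Linear independence of two vectors, in the form in which the closing condition around a
  2-face produces it: an equation between a multiple of \<open>u\<close> and a multiple of
  \<open>v\<close>.\<close>

lemma not_collinear_0_iff:
  fixes u v :: "'a::real_vector"
  shows "\<not> collinear {0, u, v} \<longleftrightarrow> (\<forall>s t. s *\<^sub>R u = t *\<^sub>R v \<longrightarrow> s = 0 \<and> t = 0)"
proof
  assume nc: "\<not> collinear {0, u, v}"
  show "\<forall>s t. s *\<^sub>R u = t *\<^sub>R v \<longrightarrow> s = 0 \<and> t = 0"
  proof (intro allI impI)
    fix s t assume eq: "s *\<^sub>R u = t *\<^sub>R v"
    have nz: "u \<noteq> 0" "v \<noteq> 0" "\<And>c. v \<noteq> c *\<^sub>R u" using nc by (auto simp: collinear_lemma)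
    have "t = 0"
    proof (rule ccontr)
      assume "t \<noteq> 0"
      then have "v = (s / t) *\<^sub>R u" using eq by (metis scaleR_one scaleR_scaleR divide_inverse_commute left_inverse)
      then show False using nz by blast
    qed
    then show "s = 0 \<and> t = 0" using eq nz by simp
  qed
next
  assume *: "\<forall>s t. s *\<^sub>R u = t *\<^sub>R v \<longrightarrow> s = 0 \<and> t = 0"
  have "u \<noteq> 0" using *[rule_format, of 1 0] by auto
  moreover have "v \<noteq> 0" using *[rule_format, of 0 1] by auto
  moreover have "v \<noteq> c *\<^sub>R u" for c using *[rule_format, of c 1] by auto
  ultimately show "\<not> collinear {0, u, v}" by (auto simp: collinear_lemma)
qed

text \<open>Any of the four vertices can serve as the base point if the signs of \<open>u\<close>
  and \<open>v\<close> are adapted. \<open>par_swap\<close> and \<open>par_flip\<close> generate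
  these changes, so arguments about a vertex or a side only treat one position.\<close>

abbreviation par :: "'a::euclidean_space \<Rightarrow> 'a \<Rightarrow> 'a \<Rightarrow> 'a set" where
  "par a u v \<equiv> convex hull {a, a + u, a + v, a + u + v}"

lemma par_swap: "par a u v = par a v u"
  by (simp add: insert_commute add_ac)

lemma par_flip: "par a u v = par (a + u) (- u) v"
  by (simp add: insert_commute add_ac)

lemma not_collinear_swap: "\<not> collinear {0, u, v} \<Longrightarrow> \<not> collinear {0, v, u}"
  by (simp add: insert_commute)

lemma not_collinear_flip:
  fixes u v :: "'a::real_vector"
  shows "\<not> collinear {0, u, v} \<Longrightarrow> \<not> collinear {0, - u, v}"
  unfolding not_collinear_0_iff by (metis add.inverse_inverse neg_equal_0_iff_equal scaleR_minus_left scaleR_minus_right)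

text \<open>\<open>g\<close> is the component of \<open>v\<close> orthogonal to \<open>u\<close>; it
  is nonzero by independence and satisfies \<open>g \<bullet> v = g \<bullet> g\<close>.\<close>

lemma not_collinear_normal:
  fixes u v :: "'a::euclidean_space"
  assumes "\<not> collinear {0, u, v}"
  obtains g where "g \<bullet> u = 0" "0 < g \<bullet> v"
proof -
  have uz: "u \<noteq> 0" using assms by auto
  define g where "g = v - ((v \<bullet> u) / (u \<bullet> u)) *\<^sub>R u"
  have gu: "g \<bullet> u = 0" using uz unfolding g_def by (simp add: inner_diff_left)
  have "g \<noteq> 0" using assms unfolding g_def collinear_lemma by auto
  moreover have "g \<bullet> v = g \<bullet> g"
  proof -
    have "v = g + ((v \<bullet> u) / (u \<bullet> u)) *\<^sub>R u" unfolding g_def by simp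
    then have "g \<bullet> v = g \<bullet> g + ((v \<bullet> u) / (u \<bullet> u)) * (g \<bullet> u)"
      by (metis inner_add_right inner_scaleR_right)
    then show ?thesis using gu by simp
  qed
  ultimately show ?thesis using gu that by simp
qed

text \<open>The functional that vanishes on \<open>u\<close> and is positive on \<open>v\<close>
  attains its minimum over the four corners exactly at \<open>a\<close> and
  \<open>a + u\<close>.\<close>

lemma par_side:
  fixes u v :: "'a::euclidean_space"
  assumes "\<not> collinear {0, u, v}"
  shows "adjacent (par a u v) a (a + u)"
proof -
  obtain g where g: "g \<bullet> u = 0" "0 < g \<bullet> v" using not_collinear_normal assms by blast
  let ?S = "{a, a + u, a + v, a + u + v}"
  define T where "T = par a u v \<inter> {x. g \<bullet> x = g \<bullet> a}"
  have "par a u v \<subseteq> {x. g \<bullet> x \<ge> g \<bullet> a}"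
    using g by (intro hull_minimal) (auto simp: convex_halfspace_ge inner_add_right)
  then have T: "T face_of par a u v"
    unfolding T_def by (intro face_of_Int_supporting_hyperplane_ge) auto
  then obtain S' where S': "S' \<subseteq> ?S" "T = convex hull S'"
    using face_of_convex_hull_subset[of ?S T] by (auto simp: finite_imp_compact)
  have "S' \<subseteq> T" unfolding S'(2) by (rule hull_subset)
  have "S' \<subseteq> {a, a + u}"
  proof
    fix x assume "x \<in> S'"
    then have "x \<in> ?S" "g \<bullet> x = g \<bullet> a" using S'(1) \<open>S' \<subseteq> T\<close> unfolding T_def by blast+
    then show "x \<in> {a, a + u}" using g by (auto simp: inner_add_right)
  qed
  then have "T \<subseteq> closed_segment a (a + u)"
    unfolding S'(2) segment_convex_hull by (rule hull_mono)
  moreover have "closed_segment a (a + u) \<subseteq> T"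
  proof -
    have "{a, a + u} \<subseteq> T" using g hull_subset[of ?S convex] unfolding T_def by (auto simp: inner_add_right)
    then show ?thesis using face_of_imp_convex[OF T] by (simp add: closed_segment_subset)
  qed
  ultimately have "T = closed_segment a (a + u)" by blast
  moreover have "aff_dim (closed_segment a (a + u)) = 1"
    using assms aff_dim_2[of a "a + u"] by (auto simp: segment_convex_hull aff_dim_convex_hull)
  ultimately show ?thesis using T by (simp add: edge_of_def)
qed

lemma par_opposite_sides_disjoint:
  fixes u v :: "'a::euclidean_space"
  assumes "\<not> collinear {0, u, v}"
  shows "closed_segment a (a + u) \<inter> closed_segment (a + v) (a + u + v) = {}"
proof -
  obtain g where g: "g \<bullet> u = 0" "0 < g \<bullet> v" using not_collinear_normal assms by blast
  have "closed_segment a (a + u) \<subseteq> {x. g \<bullet> x = g \<bullet> a}"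
    using g by (intro closed_segment_subset) (auto simp: convex_hyperplane inner_add_right)
  moreover have "closed_segment (a + v) (a + u + v) \<subseteq> {x. g \<bullet> x = g \<bullet> a + g \<bullet> v}"
    using g by (intro closed_segment_subset) (auto simp: convex_hyperplane inner_add_right)
  ultimately show ?thesis using g by fastforce
qed

text \<open>The diagonals share their midpoint, so a face containing one of them would contain the
  ends of the other.\<close>

lemma par_no_diagonal:
  fixes u v :: "'a::euclidean_space"
  assumes nc: "\<not> collinear {0, u, v}"
  shows "\<not> adjacent (par a u v) a (a + u + v)"
proof
  assume "adjacent (par a u v) a (a + u + v)"
  then have F: "closed_segment a (a + u + v) face_of par a u v" by (simp add: edge_of_def)
  let ?m = "midpoint a (a + u + v)"
  have "u \<noteq> v" using nc by auto
  moreover have eq: "?m = midpoint (a + u) (a + v)" by (simp add: midpoint_def algebra_simps)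
  ultimately have "?m \<in> open_segment (a + u) (a + v)" by (metis add_left_cancel midpoint_in_open_segment)
  moreover have "a + u \<in> par a u v" "a + v \<in> par a u v" by (simp_all add: hull_inc)
  moreover have "?m \<in> closed_segment a (a + u + v)" by simp
  ultimately have "a + u \<in> closed_segment a (a + u + v)" using face_ofD[OF F] by blast
  then obtain s where "a + u = (1 - s) *\<^sub>R a + s *\<^sub>R (a + u + v)" by (auto simp: in_segment)
  then have "(1 - s) *\<^sub>R u = s *\<^sub>R v" by (simp add: algebra_simps)
  then show False using nc unfolding not_collinear_0_iff by fastforce
qed

lemma par_corner:
  fixes F :: "'a::euclidean_space set"
  assumes "parallelogram F" "p extreme_point_of F"
  obtains u v where "\<not> collinear {0, u, v}" "F = par p u v"
proof -
  obtain a u v where nc: "\<not> collinear {0, u, v}" and F: "F = par a u v"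
    using assms(1) unfolding parallelogram_def by blast
  have "p \<in> {a, a + u, a + v, a + u + v}"
    using assms(2) extreme_point_of_convex_hull unfolding F by blast
  then consider "p = a" | "p = a + u" | "p = a + v" | "p = a + u + v" by blast
  then show ?thesis
  proof cases
    case 1 then show ?thesis using that nc F by blast
  next
    case 2 then show ?thesis using that[OF not_collinear_flip[OF nc]] F par_flip by metis
  next
    case 3
    then show ?thesis
      using that[OF not_collinear_flip[OF not_collinear_swap[OF nc]]] F par_flip par_swap by metis
  next
    case 4
    have "F = par (a + u) v (- u)" using F par_flip par_swap by metis
    then have "F = par p (- v) (- u)" using 4 par_flip by metis
    then show ?thesis
      using that[OF not_collinear_flip[OF not_collinear_swap[OF not_collinear_flip[OF nc]]]] by blast
  qed
qed

lemma par_adjacent: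
  fixes u v :: "'a::euclidean_space"
  assumes "\<not> collinear {0, u, v}" "adjacent (par p u v) p x"
  shows "x = p + u \<or> x = p + v"
  using adjacent_extreme(2)[OF assms(2)] adjacent_neq[OF assms(2)]
    extreme_point_of_convex_hull[of x "{p, p + u, p + v, p + u + v}"] par_no_diagonal[OF assms(1)] assms(2)
  by blast

lemma par_at_edge:
  fixes F :: "'a::euclidean_space set"
  assumes "parallelogram F" "adjacent F p x"
  obtains v where "\<not> collinear {0, x - p, v}" "F = par p (x - p) v"
proof -
  obtain u v where *: "\<not> collinear {0, u, v}" "F = par p u v"
    using par_corner adjacent_extreme assms by metis
  then consider "x = p + u" | "x = p + v" using par_adjacent assms(2) by metis
  then show ?thesis
  proof cases
    case 1 then show ?thesis using * that[of v] by simp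
  next
    case 2
    then have "x - p = v" by simp
    then show ?thesis using that[of u] not_collinear_swap[OF *(1)] *(2) par_swap[of p u v] by simp
  qed
qed

lemma par_sides:
  fixes u v :: "'a::euclidean_space"
  assumes nc: "\<not> collinear {0, u, v}"
  shows "adjacent (par p u v) p (p + u)" "adjacent (par p u v) p (p + v)"
    "adjacent (par p u v) (p + v) (p + u + v)" "adjacent (par p u v) (p + u) (p + u + v)"
proof -
  have *: "adjacent (par p u v) p (p + u)" "adjacent (par p u v) (p + v) (p + u + v)"
    if nc: "\<not> collinear {0, u, v}" for u v
  proof -
    show "adjacent (par p u v) p (p + u)" using par_side nc by blast
    have "\<not> collinear {0, u, - v}" using nc not_collinear_flip not_collinear_swap by metis
    then have "adjacent (par (p + v) u (- v)) (p + v) (p + v + u)" by (rule par_side)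
    moreover have "par (p + v) u (- v) = par p u v" by (simp add: insert_commute add_ac)
    ultimately show "adjacent (par p u v) (p + v) (p + u + v)" by (simp only: add_ac)
  qed
  show "adjacent (par p u v) p (p + u)" "adjacent (par p u v) (p + v) (p + u + v)" using *[OF nc] .
  show "adjacent (par p u v) p (p + v)" "adjacent (par p u v) (p + u) (p + u + v)"
    using *[OF not_collinear_swap[OF nc]] par_swap[of p u v] by (simp_all only: add_ac)
qed

text \<open>This justifies disjointness as the criterion for opposite sides: an edge avoiding
  \<open>p\<close> and \<open>p + u\<close> has only two corners left for its ends.\<close>

lemma par_opposite_edge:
  fixes u v :: "'a::euclidean_space"
  assumes "f edge_of par p u v" "closed_segment p (p + u) \<inter> f = {}"
  shows "f = closed_segment (p + v) (p + u + v)"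
proof -
  have "polytope (par p u v)" by (simp add: polytope_convex_hull)
  then obtain z w where zw: "z \<noteq> w" "z extreme_point_of par p u v" "w extreme_point_of par p u v"
      "f = closed_segment z w"
    using polytope_edge_obtain assms(1) by metis
  then have "z \<in> {p, p + u, p + v, p + u + v}" "w \<in> {p, p + u, p + v, p + u + v}"
    using extreme_point_of_convex_hull by blast+
  moreover have "z \<notin> {p, p + u}" "w \<notin> {p, p + u}" using assms(2) zw(4) by auto
  ultimately show ?thesis using zw by (auto simp: closed_segment_commute)
qed

section \<open>Vertices and edges of triangles\<close>

lemma triangle_two_vertices:
  fixes F :: "'a::euclidean_space set"
  assumes "2 simplex F" "p extreme_point_of F" "x extreme_point_of F" "p \<noteq> x"
  shows "adjacent F p x"
proof -
  obtain C where C: "\<not> affine_dependent C" "F = convex hull C"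
    using assms(1) unfolding simplex_def by blast
  have "{p, x} \<subseteq> C" using assms extreme_point_of_convex_hull C by blast
  then have "closed_segment p x face_of F"
    using face_of_convex_hull_affine_independent[OF C(1)] C(2) unfolding segment_convex_hull by blast
  then show ?thesis
    using assms(4) by (simp add: edge_of_def segment_convex_hull aff_dim_convex_hull)
qed

lemma triangle_vertices:
  fixes F :: "'a::euclidean_space set"
  assumes "2 simplex F"
  shows "card {v. v extreme_point_of F} = 3" "\<not> affine_dependent {v. v extreme_point_of F}"
proof -
  obtain C where C: "\<not> affine_dependent C" "F = convex hull C" "int (card C) = 3"
    using assms unfolding simplex_def by auto
  then have "{v. v extreme_point_of F} = C"
    using extreme_point_of_convex_hull_affine_independent by blast
  with C show "card {v. v extreme_point_of F} = 3" "\<not> affine_dependent {v. v extreme_point_of F}" by auto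
qed

lemma triangle_not_collinear:
  fixes F :: "'a::euclidean_space set"
  assumes "2 simplex F" "p extreme_point_of F" "x extreme_point_of F" "y extreme_point_of F"
    and "p \<noteq> x" "p \<noteq> y" "x \<noteq> y"
  shows "\<not> collinear {0, x - p, y - p}"
proof -
  have "{p, x, y} \<subseteq> {v. v extreme_point_of F}" using assms by blast
  then have "\<not> affine_dependent {p, x, y}" using triangle_vertices(2)[OF assms(1)] affine_independent_subset by blast
  then have "\<not> collinear {p, x, y}" using assms by (simp add: collinear_3_eq_affine_dependent)
  moreover have "collinear {p, x, y} \<longleftrightarrow> collinear {0, x - p, y - p}"
    using collinear_3[of x p y] by (simp add: insert_commute)
  ultimately show ?thesis by simp
qed

text \<open>Two disjoint edges would need four vertices. The common vertex is put first in both
  segments.\<close>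

lemma triangle_edges_meet:
  fixes F :: "'a::euclidean_space set"
  assumes "2 simplex F" "e edge_of F" "f edge_of F" "e \<noteq> f"
  obtains p x y where "e = closed_segment p x" "f = closed_segment p y" "p \<noteq> x" "p \<noteq> y" "x \<noteq> y"
    "p extreme_point_of F" "x extreme_point_of F" "y extreme_point_of F"
proof -
  let ?V = "{v. v extreme_point_of F}"
  have poly: "polytope F" using assms(1) simplex_imp_polytope by blast
  obtain p x where e: "p \<noteq> x" "p \<in> ?V" "x \<in> ?V" "e = closed_segment p x"
    using polytope_edge_obtain[OF poly assms(2)] by blast
  obtain p' y where f: "p' \<noteq> y" "p' \<in> ?V" "y \<in> ?V" "f = closed_segment p' y"
    using polytope_edge_obtain[OF poly assms(3)] by blast
  have "{p, x} \<inter> {p', y} \<noteq> {}"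
  proof
    assume "{p, x} \<inter> {p', y} = {}"
    then have "card {p, x, p', y} = 4" using e f by auto
    moreover have "card {p, x, p', y} \<le> card ?V"
      using e f by (intro card_mono polytope_extreme_finite poly) auto
    ultimately show False using triangle_vertices(1)[OF assms(1)] by simp
  qed
  then consider "p = p'" | "p = y" | "x = p'" | "x = y" by blast
  then show ?thesis
    using that[of p x y] that[of p x p'] that[of x p y] that[of x p p'] e f assms(4)
    by cases (auto simp: closed_segment_commute)
qed

lemma edge_step_scalars_eq:
  fixes P :: "'a::euclidean_space set"
  assumes step: "edge_step P e f"
    and q: "\<And>z w. adjacent P z w \<Longrightarrow> q z - q w = l (closed_segment z w) *\<^sub>R (z - w)"
  shows "l e = l f"
proof -
  obtain F where F: "F face_of P" and ef: "e edge_of F" "f edge_of F"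
    and cases: "2 simplex F \<or> parallelogram F \<and> e \<inter> f = {}"
    using step unfolding edge_step_def by blast
  have qF: "q z - q w = l (closed_segment z w) *\<^sub>R (z - w)" if "adjacent F z w" for z w
    using q that edge_of_face[OF F] by blast
  from cases show ?thesis
  proof (elim disjE conjE)
    assume tri: "2 simplex F"
    show ?thesis
    proof (cases "e = f")
      case False
      obtain p x y where *: "e = closed_segment p x" "f = closed_segment p y" "p \<noteq> x" "p \<noteq> y" "x \<noteq> y"
          "p extreme_point_of F" "x extreme_point_of F" "y extreme_point_of F"
        using triangle_edges_meet[OF tri ef False] by blast
      let ?g = "closed_segment x y"
      have "q p - q x = l e *\<^sub>R (p - x)" "q p - q y = l f *\<^sub>R (p - y)" "q x - q y = l ?g *\<^sub>R (x - y)"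
        using qF triangle_two_vertices[OF tri] * by auto
      then have "l e *\<^sub>R (p - x) + l ?g *\<^sub>R (x - y) = l f *\<^sub>R (p - y)"
        by (metis diff_add_cancel add_diff_eq)
      \<comment> \<open>Written in the independent vectors \<open>x - p\<close> and
        \<open>y - p\<close>, the closing condition makes both coefficients vanish, so all three
        scalars agree.\<close>
      then have "(l ?g - l e) *\<^sub>R (x - p) = (l ?g - l f) *\<^sub>R (y - p)"
        by (simp add: algebra_simps)
      then show ?thesis
        using triangle_not_collinear[OF tri *(6-8) *(3-5)] unfolding not_collinear_0_iff by fastforce
    qed simp
  next
    assume par: "parallelogram F" and dis: "e \<inter> f = {}"
    have "polytope F" using par unfolding parallelogram_def by (auto simp: polytope_convex_hull)
    then obtain p x where e: "e = closed_segment p x" using polytope_edge_obtain ef(1) by metis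
    then obtain v where nc: "\<not> collinear {0, x - p, v}" and Fp: "F = par p (x - p) v"
      using par_at_edge[OF par] ef(1) by metis
    define u where "u = x - p"
    have x: "x = p + u" by (simp add: u_def)
    have nc: "\<not> collinear {0, u, v}" and Fp: "F = par p u v" using nc Fp by (simp_all add: u_def)
    have f: "f = closed_segment (p + v) (p + u + v)"
      using par_opposite_edge[of f p u v] ef dis unfolding Fp e x by blast
    have "q p - q (p + u) = l e *\<^sub>R (p - (p + u))"
      "q (p + v) - q (p + u + v) = l f *\<^sub>R (p + v - (p + u + v))"
      "q p - q (p + v) = l (closed_segment p (p + v)) *\<^sub>R (p - (p + v))"
      "q (p + u) - q (p + u + v) = l (closed_segment (p + u) (p + u + v)) *\<^sub>R (p + u - (p + u + v))"
      unfolding e f x by (intro qF, unfold Fp, intro par_sides[OF nc])+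
    \<comment> \<open>The corner opposite to \<open>p\<close> is reached along two pairs of sides;
      both give its value under \<open>q\<close>.\<close>
    then have "q (p + u + v) = q p + (l e *\<^sub>R u + l (closed_segment (p + u) (p + u + v)) *\<^sub>R v)"
      "q (p + u + v) = q p + (l (closed_segment p (p + v)) *\<^sub>R v + l f *\<^sub>R u)"
      by (simp_all add: algebra_simps) (metis add.assoc add.commute)+
    then have "l e *\<^sub>R u + l (closed_segment (p + u) (p + u + v)) *\<^sub>R v
        = l (closed_segment p (p + v)) *\<^sub>R v + l f *\<^sub>R u"
      by (metis add_left_cancel)
    then have "(l e - l f) *\<^sub>R u
        = (l (closed_segment p (p + v)) - l (closed_segment (p + u) (p + u + v))) *\<^sub>R v"
      by (simp add: algebra_simps)
    then show ?thesis using nc unfolding not_collinear_0_iff by fastforce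
  qed
qed

text \<open>The consistency check for extending \<open>q\<close> downwards to \<open>p\<close>. Only
  edges strictly above \<open>p\<close> may be used, as \<open>q\<close> is not yet a potential
  elsewhere: the third side of a triangle, or the two sides of a parallelogram that do not contain
  \<open>p\<close>.\<close>

lemma potential_at_corner:
  fixes P :: "'a::euclidean_space set"
  assumes F: "F face_of P" "aff_dim F = 2" "2 simplex F \<or> parallelogram F"
    and px: "adjacent P p x" "closed_segment p x \<subseteq> F" "c \<bullet> p < c \<bullet> x"
    and py: "adjacent P p y" "closed_segment p y \<subseteq> F" "c \<bullet> p < c \<bullet> y"
    and l: "\<And>e f. edge_step P e f \<Longrightarrow> l e = l f"
    and q: "\<And>z w. adjacent P z w \<Longrightarrow> c \<bullet> p < c \<bullet> z \<Longrightarrow> c \<bullet> p < c \<bullet> w \<Longrightarrow>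
        q z - q w = l (closed_segment z w) *\<^sub>R (z - w)"
  shows "q x + l (closed_segment p x) *\<^sub>R (p - x) = q y + l (closed_segment p y) *\<^sub>R (p - y)"
proof (cases "x = y")
  case False
  have pxF: "adjacent F p x" and pyF: "adjacent F p y" using px py edge_of_face[OF F(1)] by blast+
  show ?thesis
    using F(3)
  proof
    assume tri: "2 simplex F"
    have xyF: "adjacent F x y"
      using triangle_two_vertices[OF tri] False adjacent_extreme[OF pxF] adjacent_extreme[OF pyF] by blast
    have "edge_step P (closed_segment p x) (closed_segment p y)"
      "edge_step P (closed_segment p x) (closed_segment x y)"
      unfolding edge_step_def using F tri pxF pyF xyF by blast+
    then have "l (closed_segment p y) = l (closed_segment p x)" "l (closed_segment x y) = l (closed_segment p x)"
      using l by metis+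
    moreover have "q x - q y = l (closed_segment x y) *\<^sub>R (x - y)"
      using q xyF px py edge_of_face[OF F(1)] by blast
    ultimately show ?thesis by (simp add: algebra_simps)
  next
    assume par: "parallelogram F"
    obtain v where v: "\<not> collinear {0, x - p, v}" "F = par p (x - p) v"
      using par_at_edge[OF par pxF] by blast
    then have yv: "y = p + v" using par_adjacent[of "x - p" v p y] pyF False by auto
    define u where "u = x - p"
    have x: "x = p + u" by (simp add: u_def)
    have nc: "\<not> collinear {0, u, v}" and Fp: "F = par p u v" using v by (simp_all add: u_def)
    note sides = par_sides[OF nc, of p, folded Fp yv x]
    have "edge_step P (closed_segment p x) (closed_segment y (x + v))"
      "edge_step P (closed_segment p y) (closed_segment x (x + v))"
      unfolding edge_step_def
      using F(1,2) par sides par_opposite_sides_disjoint[OF nc, of p, folded yv x]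
        par_opposite_sides_disjoint[OF not_collinear_swap[OF nc], of p, folded yv x] yv x
      by (auto simp: add_ac intro!: exI[of _ F])
    then have ll: "l (closed_segment y (x + v)) = l (closed_segment p x)"
      "l (closed_segment x (x + v)) = l (closed_segment p y)" using l by metis+
    \<comment> \<open>Both sides at \<open>p\<close> go up, so the opposite corner is above
      \<open>p\<close> and \<open>q\<close> is already known there.\<close>
    have "c \<bullet> p < c \<bullet> (x + v)" using px(3) py(3) x yv by (simp add: inner_add_right)
    then have "q x - q (x + v) = l (closed_segment x (x + v)) *\<^sub>R (x - (x + v))"
      "q y - q (x + v) = l (closed_segment y (x + v)) *\<^sub>R (y - (x + v))"
      using q sides px py edge_of_face[OF F(1)] by blast+
    then have "q x = q (x + v) - l (closed_segment p y) *\<^sub>R v" "q y = q (x + v) - l (closed_segment p x) *\<^sub>R u"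
      unfolding ll using yv x by (simp_all add: algebra_simps)
    then show ?thesis using yv x by (simp add: algebra_simps)
  qed
qed simp

section \<open>Deformations and edge potentials\<close>

lemma finite_edges:
  fixes P :: "'a::euclidean_space set"
  shows "polytope P \<Longrightarrow> finite (edges P)"
  using finite_polytope_faces[of P] unfolding edges_def edge_of_def by (auto elim: rev_finite_subset)

lemma lookup_sum_single:
  assumes "finite X"
  shows "Poly_Mapping.lookup (\<Sum>e\<in>X. Poly_Mapping.single e (f e)) e' = (if e' \<in> X then f e' else 0)"
  using assms by (simp add: lookup_sum lookup_single when_def)

lemma lookup_scaleR [simp]:
  "Poly_Mapping.lookup (r *\<^sub>R x) i = r *\<^sub>R Poly_Mapping.lookup x i"
  for x :: "'b \<Rightarrow>\<^sub>0 real"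
proof -
  have "{i. r *\<^sub>R Poly_Mapping.lookup x i \<noteq> 0} \<subseteq> {i. Poly_Mapping.lookup x i \<noteq> 0}" by auto
  then have "finite {i. r *\<^sub>R Poly_Mapping.lookup x i \<noteq> 0}" using finite_lookup finite_subset by blast
  then show ?thesis by (simp add: scaleR_poly_mapping_def)
qed

lemma lookup_char_vector:
  "finite X \<Longrightarrow> Poly_Mapping.lookup (char_vector X) e = (if e \<in> X then 1 else 0)"
  unfolding char_vector_def by (rule lookup_sum_single)

text \<open>Neither a sign condition on \<open>l\<close> nor a polytope spanned by the values of
  \<open>q\<close> is included. The same notion thus covers the vertex map of a deformation, that of
  a complementary summand, and a solution of the closing conditions alone.\<close>

definition edge_potential :: "'a::euclidean_space set \<Rightarrow> ('a \<Rightarrow> 'a) \<Rightarrow> ('a set \<Rightarrow> real) \<Rightarrow> bool" where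
  "edge_potential P q l \<longleftrightarrow>
     (\<forall>z w. adjacent P z w \<longrightarrow> q z - q w = l (closed_segment z w) *\<^sub>R (z - w))"

lemma edge_deformation_vector_alt:
  "edge_deformation_vector P Q v \<longleftrightarrow>
     Poly_Mapping.keys v \<subseteq> edges P \<and> (\<forall>e\<in>edges P. 0 \<le> Poly_Mapping.lookup v e) \<and>
     (\<exists>q. associated_vertices P Q q \<and> edge_potential P q (Poly_Mapping.lookup v))"
  unfolding edge_deformation_vector_def edge_potential_def edges_def by blast

lemma normal_cone_singleton: "c \<in> normal_cone P {p} \<longleftrightarrow> (\<forall>y\<in>P. c \<bullet> y \<le> c \<bullet> p)"
  by (simp add: normal_cone_def)

section \<open>Minkowski sums, summands and their vertices\<close>

lemma polytope_set_plus:
  fixes A B :: "'a::euclidean_space set"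
  assumes "polytope A" "polytope B"
  shows "polytope (A + B)"
proof -
  obtain X Y where "finite X" "A = convex hull X" "finite Y" "B = convex hull Y"
    using assms unfolding polytope_def by blast
  then have "A + B = convex hull (X + Y)" "finite (X + Y)"
    by (simp_all add: convex_hull_set_plus finite_set_plus)
  then show ?thesis by (simp add: polytope_convex_hull)
qed

lemma set_plus_nonempty: "A \<noteq> {} \<Longrightarrow> B \<noteq> {} \<Longrightarrow> A + B \<noteq> {}"
  by (metis all_not_in_conv set_plus_intro)

lemma scaleR_image_set_plus:
  fixes A B :: "'a::real_vector set"
  shows "(\<lambda>x. l *\<^sub>R x) ` (A + B) = (\<lambda>x. l *\<^sub>R x) ` A + (\<lambda>x. l *\<^sub>R x) ` B"
  by (force simp: set_plus_def scaleR_add_right)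

text \<open>Convexity enters in one inclusion: \<open>l *\<^sub>R a + m *\<^sub>R b\<close> is
  \<open>l + m\<close> times a weighted mean of \<open>a\<close> and \<open>b\<close>, unless both
  factors are 0.\<close>

lemma convex_scaleR_add_image:
  fixes P :: "'a::real_vector set"
  assumes "convex P" "0 \<le> l" "0 \<le> m"
  shows "(\<lambda>x. (l + m) *\<^sub>R x) ` P = (\<lambda>x. l *\<^sub>R x) ` P + (\<lambda>x. m *\<^sub>R x) ` P"
proof
  show "(\<lambda>x. (l + m) *\<^sub>R x) ` P \<subseteq> (\<lambda>x. l *\<^sub>R x) ` P + (\<lambda>x. m *\<^sub>R x) ` P"
    by (auto simp: scaleR_add_left)
  show "(\<lambda>x. l *\<^sub>R x) ` P + (\<lambda>x. m *\<^sub>R x) ` P \<subseteq> (\<lambda>x. (l + m) *\<^sub>R x) ` P"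
  proof
    fix z assume "z \<in> (\<lambda>x. l *\<^sub>R x) ` P + (\<lambda>x. m *\<^sub>R x) ` P"
    then obtain a b where ab: "a \<in> P" "b \<in> P" "z = l *\<^sub>R a + m *\<^sub>R b" by (auto simp: set_plus_def)
    show "z \<in> (\<lambda>x. (l + m) *\<^sub>R x) ` P"
    proof (cases "l + m = 0")
      case True
      then have "l = 0" "m = 0" using assms by auto
      then show ?thesis using ab by auto
    next
      case False
      let ?w = "(l / (l + m)) *\<^sub>R a + (m / (l + m)) *\<^sub>R b"
      have "?w \<in> P" using assms ab False
        by (intro convexD) (auto simp: add_divide_distrib[symmetric])
      moreover have "z = (l + m) *\<^sub>R ?w" using ab False by (simp add: scaleR_add_right)
      ultimately show ?thesis by blast
    qed
  qed
qed

text \<open>The translate of \<open>Q\<close> by \<open>y\<close> lies inside the dilated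
  \<open>P\<close> and touches its vertex \<open>l *\<^sub>R p\<close> at \<open>x + y\<close>, so
  \<open>x\<close> inherits extremality and normal vectors from \<open>p\<close>.\<close>

lemma summand_vertex:
  fixes P :: "'a::euclidean_space set"
  assumes dec: "(\<lambda>x. l *\<^sub>R x) ` P = Q + R" and l: "0 < l"
    and p: "p extreme_point_of P" and xy: "x \<in> Q" "y \<in> R" "x + y = l *\<^sub>R p"
  shows "x extreme_point_of Q" "normal_cone P {p} \<subseteq> normal_cone Q {x}"
proof -
  have lift: "\<exists>z'\<in>P. z + y = l *\<^sub>R z'" if "z \<in> Q" for z
    using dec set_plus_intro[OF that xy(2)] by auto
  show "x extreme_point_of Q"
    unfolding extreme_point_of_def
  proof (intro conjI ballI notI)
    fix a b assume ab: "a \<in> Q" "b \<in> Q" "x \<in> open_segment a b"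
    obtain a' b' where a': "a' \<in> P" "a + y = l *\<^sub>R a'" and b': "b' \<in> P" "b + y = l *\<^sub>R b'"
      using lift ab by metis
    obtain u where u: "0 < u" "u < 1" "x = (1 - u) *\<^sub>R a + u *\<^sub>R b" and "a \<noteq> b"
      using ab(3) by (auto simp: in_segment)
    have "l *\<^sub>R p = (1 - u) *\<^sub>R (a + y) + u *\<^sub>R (b + y)"
      using xy(3) u(3) by (simp add: algebra_simps)
    also have "\<dots> = l *\<^sub>R ((1 - u) *\<^sub>R a' + u *\<^sub>R b')"
      unfolding a' b' by (simp add: algebra_simps)
    finally have "p = (1 - u) *\<^sub>R a' + u *\<^sub>R b'" using l by simp
    moreover have "a' \<noteq> b'" using \<open>a \<noteq> b\<close> a'(2) b'(2) by (metis add_right_cancel)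
    ultimately have "p \<in> open_segment a' b'" using u by (auto simp: in_segment)
    then show False using p a' b' unfolding extreme_point_of_def by blast
  qed (fact xy(1))
  show "normal_cone P {p} \<subseteq> normal_cone Q {x}"
  proof
    fix c assume c: "c \<in> normal_cone P {p}"
    have "c \<bullet> z \<le> c \<bullet> x" if z: "z \<in> Q" for z
    proof -
      obtain z' where z': "z' \<in> P" "z + y = l *\<^sub>R z'" using lift z by blast
      then have "c \<bullet> (z + y) \<le> c \<bullet> (x + y)"
        using c l unfolding z'(2) xy(3) by (simp add: normal_cone_singleton)
      then show ?thesis by (simp add: inner_add_right)
    qed
    then show "c \<in> normal_cone Q {x}" by (simp add: normal_cone_singleton)
  qed
qed

text \<open>Connects an arbitrary associated vertex map with an arbitrary decomposition. If
  \<open>l *\<^sub>R p = x + y\<close>, a functional exposing \<open>p\<close> is at least as large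
  at \<open>q p\<close> as at \<open>x\<close>; hence \<open>q p + y\<close> is no lower than
  \<open>l *\<^sub>R p\<close> and must equal it.\<close>

lemma associated_vertices_complement:
  fixes P :: "'a::euclidean_space set"
  assumes "polytope P" and dec: "(\<lambda>x. l *\<^sub>R x) ` P = Q + R" and l: "0 < l"
    and q: "associated_vertices P Q q" and p: "p extreme_point_of P"
  obtains y where "y \<in> R" "q p + y = l *\<^sub>R p"
proof -
  have "l *\<^sub>R p \<in> Q + R" using p dec by (auto simp: extreme_point_of_def)
  then obtain x y where xy: "x \<in> Q" "y \<in> R" "l *\<^sub>R p = x + y" by (auto simp: set_plus_def)
  obtain c where c: "\<And>z. z \<in> P \<Longrightarrow> z \<noteq> p \<Longrightarrow> c \<bullet> z < c \<bullet> p"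
    using polytope_extreme_exposed assms(1) p by blast
  then have "c \<in> normal_cone P {p}" by (force simp: normal_cone_singleton)
  then have qp: "q p \<in> Q" "c \<bullet> x \<le> c \<bullet> q p"
    using q p xy(1) unfolding associated_vertices_def normal_cone_def extreme_point_of_def by blast+
  then obtain z where z: "z \<in> P" "q p + y = l *\<^sub>R z"
    using dec set_plus_intro[OF qp(1) xy(2)] by auto
  have "z = p"
  proof (rule ccontr)
    assume "z \<noteq> p"
    then have "c \<bullet> (l *\<^sub>R z) < c \<bullet> (l *\<^sub>R p)" using c z l by simp
    then show False using qp(2) unfolding z(2)[symmetric] xy(3) by (simp add: inner_add_right)
  qed
  then show ?thesis using that xy z by blast
qed

text \<open>A functional with unique maximizer \<open>p\<close> on \<open>P\<close> has unique
  maximizer \<open>q p\<close> on \<open>Q\<close>: adding the complementary point of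
  \<open>R\<close> to another maximizer would give a second maximizer on the dilated
  \<open>P\<close>.\<close>

lemma associated_vertex_exposed:
  fixes P :: "'a::euclidean_space set"
  assumes "polytope P" "deformation P Q" "associated_vertices P Q q"
    and p: "p extreme_point_of P" "\<And>x. x \<in> P \<Longrightarrow> x \<noteq> p \<Longrightarrow> c \<bullet> x < c \<bullet> p"
    and z: "z \<in> Q" "c \<bullet> q p \<le> c \<bullet> z"
  shows "z = q p"
proof -
  obtain l R where l: "0 < l" and dec: "(\<lambda>x. l *\<^sub>R x) ` P = Q + R"
    using assms(2) unfolding deformation_def by blast
  obtain y where y: "y \<in> R" "q p + y = l *\<^sub>R p"
    using associated_vertices_complement[OF assms(1) dec l assms(3) p(1)] by blast
  obtain x where x: "x \<in> P" "z + y = l *\<^sub>R x" using dec set_plus_intro[OF z(1) y(1)] by auto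
  have "x = p"
  proof (rule ccontr)
    assume "x \<noteq> p"
    then have "c \<bullet> (l *\<^sub>R x) < c \<bullet> (l *\<^sub>R p)" using p(2) x l by simp
    then show False using z(2) unfolding x(2)[symmetric] y(2)[symmetric] by (simp add: inner_add_right)
  qed
  then show ?thesis using x y by (metis add_right_cancel)
qed

lemma associated_vertices_unique:
  fixes P :: "'a::euclidean_space set"
  assumes P: "polytope P" and dfm: "deformation P Q"
    and q: "associated_vertices P Q q" "associated_vertices P Q q'" and p: "p extreme_point_of P"
  shows "q p = q' p"
proof -
  obtain c where c: "\<And>z. z \<in> P \<Longrightarrow> z \<noteq> p \<Longrightarrow> c \<bullet> z < c \<bullet> p"
    using polytope_extreme_exposed P p by blast
  then have "c \<in> normal_cone P {p}" by (force simp: normal_cone_singleton)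
  then have "q' p \<in> Q" "c \<bullet> q p \<le> c \<bullet> q' p"
    using q p unfolding associated_vertices_def normal_cone_def extreme_point_of_def by blast+
  then show ?thesis using associated_vertex_exposed[OF P dfm q(1) p c] by metis
qed

lemma edge_deformation_vector_unique:
  fixes P :: "'a::euclidean_space set"
  assumes "polytope P" "deformation P Q" "edge_deformation_vector P Q v" "edge_deformation_vector P Q w"
  shows "v = w"
proof (rule poly_mapping_eqI)
  fix e
  show "Poly_Mapping.lookup v e = Poly_Mapping.lookup w e"
  proof (cases "e \<in> edges P")
    case True
    then have "e edge_of P" by (simp add: edges_def)
    then obtain a b where e: "e = closed_segment a b" "a \<noteq> b" by (rule polytope_edge_obtain[OF assms(1)])
    then have ad: "adjacent P a b" using True by (simp add: edges_def)
    obtain q q' where q: "associated_vertices P Q q" "edge_potential P q (Poly_Mapping.lookup v)"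
      and q': "associated_vertices P Q q'" "edge_potential P q' (Poly_Mapping.lookup w)"
      using assms(3,4) unfolding edge_deformation_vector_alt by blast
    have "q a = q' a" "q b = q' b"
      using associated_vertices_unique[OF assms(1,2) q(1) q'(1)] adjacent_extreme[OF ad] by blast+
    then have "Poly_Mapping.lookup v e *\<^sub>R (a - b) = Poly_Mapping.lookup w e *\<^sub>R (a - b)"
      using q(2) q'(2) ad e(1) unfolding edge_potential_def by metis
    then show ?thesis using e(2) by simp
  next
    case False
    then show ?thesis using assms(3,4) unfolding edge_deformation_vector_def by (metis in_keys_iff subsetD)
  qed
qed

text \<open>Exchange the summands: \<open>x + y'\<close> and \<open>x' + y\<close> lie in the
  dilated \<open>P\<close> and have the same midpoint as \<open>l *\<^sub>R p\<close> and
  \<open>l *\<^sub>R p'\<close>. The edge is a face, so both lie on its dilate, and the position of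
  \<open>x + y'\<close> there determines \<open>t\<close>.\<close>

lemma summand_edge_scalar:
  fixes P :: "'a::euclidean_space set"
  assumes dec: "(\<lambda>x. l *\<^sub>R x) ` P = Q + R" and l: "0 < l" and ad: "adjacent P p p'"
    and xy: "x \<in> Q" "y \<in> R" "x + y = l *\<^sub>R p" and xy': "x' \<in> Q" "y' \<in> R" "x' + y' = l *\<^sub>R p'"
  obtains t where "0 \<le> t" "x - x' = t *\<^sub>R (p - p')"
proof -
  have F: "closed_segment p p' face_of P" using ad by (simp add: edge_of_def)
  obtain z where z: "z \<in> P" "x + y' = l *\<^sub>R z" using dec set_plus_intro[OF xy(1) xy'(2)] by auto
  obtain z' where z': "z' \<in> P" "x' + y = l *\<^sub>R z'" using dec set_plus_intro[OF xy'(1) xy(2)] by auto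
  have "l *\<^sub>R (z + z') = l *\<^sub>R (p + p')"
    unfolding scaleR_add_right z(2)[symmetric] z'(2)[symmetric] xy(3)[symmetric] xy'(3)[symmetric]
    by (simp add: algebra_simps)
  then have mid: "midpoint z z' = midpoint p p'" using l by (simp add: midpoint_def)
  have mem: "midpoint z z' \<in> closed_segment p p'" unfolding mid by simp
  have "z \<in> closed_segment p p'"
  proof (cases "z = z'")
    case True then show ?thesis using mem by simp
  next
    case False
    then have "midpoint z z' \<in> open_segment z z'" by (simp add: midpoint_in_open_segment)
    then show ?thesis using face_ofD[OF F _ z(1) z'(1) mem] by blast
  qed
  then obtain u where u: "0 \<le> u" "u \<le> 1" "z = (1 - u) *\<^sub>R p + u *\<^sub>R p'" by (auto simp: in_segment)
  have "x - x' = (x + y') - (x' + y')" by simp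
  also have "\<dots> = (l * (1 - u)) *\<^sub>R (p - p')" unfolding z xy' u(3) by (simp add: algebra_simps)
  finally show ?thesis using that[of "l * (1 - u)"] l u by simp
qed

lemma associated_verticesI:
  fixes P :: "'a::euclidean_space set"
  assumes "(\<lambda>x. l *\<^sub>R x) ` P = Q + R" "0 < l"
    and "\<And>p. p extreme_point_of P \<Longrightarrow> q p \<in> Q \<and> (\<exists>y\<in>R. q p + y = l *\<^sub>R p)"
  shows "associated_vertices P Q q"
  unfolding associated_vertices_def using summand_vertex[OF assms(1,2)] assms(3) by metis

lemma edge_deformation_vector_exists:
  fixes P :: "'a::euclidean_space set"
  assumes "polytope P" "deformation P Q"
  obtains v where "edge_deformation_vector P Q v"
proof -
  obtain l R where l: "0 < l" and dec: "(\<lambda>x. l *\<^sub>R x) ` P = Q + R"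
    using assms(2) unfolding deformation_def by blast
  have "\<exists>x y. x \<in> Q \<and> y \<in> R \<and> x + y = l *\<^sub>R p" if "p extreme_point_of P" for p
  proof -
    have "l *\<^sub>R p \<in> Q + R" using that dec by (auto simp: extreme_point_of_def)
    then show ?thesis by (auto simp: set_plus_def)
  qed
  then obtain q r where qr: "\<And>p. p extreme_point_of P \<Longrightarrow> q p \<in> Q \<and> r p \<in> R \<and> q p + r p = l *\<^sub>R p"
    by metis
  have q: "associated_vertices P Q q" using associated_verticesI[OF dec l] qr by blast
  have "\<exists>t. 0 \<le> t \<and> (\<forall>z w. e = closed_segment z w \<longrightarrow> q z - q w = t *\<^sub>R (z - w))"
    if "e \<in> edges P" for e
  proof -
    have "e edge_of P" using that by (simp add: edges_def)
    then obtain a b where e: "e = closed_segment a b" by (rule polytope_edge_obtain[OF assms(1)])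
    then have ad: "adjacent P a b" using that by (simp add: edges_def)
    then obtain t where t: "0 \<le> t" "q a - q b = t *\<^sub>R (a - b)"
      using summand_edge_scalar[OF dec l ad] qr adjacent_extreme[OF ad] by metis
    \<comment> \<open>Only two ordered pairs of endpoints describe the segment \<open>e\<close>, and
      exchanging them negates both sides.\<close>
    have "q z - q w = t *\<^sub>R (z - w)" if "e = closed_segment z w" for z w
    proof -
      have "{z, w} = {a, b}" using that e by (simp add: closed_segment_eq)
      then consider "z = a" "w = b" | "z = b" "w = a" by (auto simp: doubleton_eq_iff)
      then show ?thesis
      proof cases
        case 2
        have "q b - q a = - (q a - q b)" by simp
        also have "\<dots> = t *\<^sub>R (b - a)" unfolding t by (simp add: algebra_simps)
        finally show ?thesis using 2 by simp
      qed (use t in simp)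
    qed
    then show ?thesis using t by blast
  qed
  then have "\<forall>e\<in>edges P. \<exists>t. 0 \<le> t \<and> (\<forall>z w. e = closed_segment z w \<longrightarrow> q z - q w = t *\<^sub>R (z - w))"
    by blast
  from bchoice[OF this] obtain t where t: "\<forall>e\<in>edges P. 0 \<le> t e \<and>
      (\<forall>z w. e = closed_segment z w \<longrightarrow> q z - q w = t e *\<^sub>R (z - w))" by blast
  define v where "v = (\<Sum>e\<in>edges P. Poly_Mapping.single e (t e))"
  have lv: "Poly_Mapping.lookup v e = (if e \<in> edges P then t e else 0)" for e
    unfolding v_def by (rule lookup_sum_single[OF finite_edges[OF assms(1)]])
  have "edge_deformation_vector P Q v"
    unfolding edge_deformation_vector_def
  proof (intro conjI exI[of _ q] q)
    show "Poly_Mapping.keys v \<subseteq> edges P" using lv by (auto simp: in_keys_iff split: if_splits)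
  qed (use lv t in auto)
  then show ?thesis using that by blast
qed

section \<open>Operations on deformations and their vectors\<close>

lemma deformation_self:
  "polytope P \<Longrightarrow> P \<noteq> {} \<Longrightarrow> deformation P P"
  unfolding deformation_def
  by (intro conjI exI[of _ "1::real"] exI[of _ "{0}"]) (simp_all add: polytope_sing set_add_0_right)

lemma edge_deformation_vector_self:
  fixes P :: "'a::euclidean_space set"
  assumes "polytope P"
  shows "edge_deformation_vector P P (char_vector (edges P))"
  unfolding edge_deformation_vector_alt edge_potential_def associated_vertices_def
  using lookup_char_vector[OF finite_edges[OF assms]]
  by (auto simp: in_keys_iff edges_def split: if_splits intro!: exI[of _ "\<lambda>x. x"])

lemma deformation_singleton:
  fixes P :: "'a::euclidean_space set"
  assumes "polytope P" "P \<noteq> {}"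
  shows "deformation P {t}" "edge_deformation_vector P {t} 0"
proof -
  have "(\<lambda>x. 1 *\<^sub>R x) ` P = {t} + (+) (- t) ` P"
    by (auto simp: set_plus_def image_iff algebra_simps)
  moreover have "polytope ((+) (- t) ` P)" using assms polytope_translation_eq by blast
  moreover have "(+) (- t) ` P \<noteq> {}" "(0::real) < 1" using assms by auto
  ultimately show "deformation P {t}"
    unfolding deformation_def using polytope_sing[of t] by blast
  show "edge_deformation_vector P {t} 0"
    unfolding edge_deformation_vector_alt edge_potential_def associated_vertices_def
    by (auto simp: normal_cone_def intro!: exI[of _ "\<lambda>_. t"])
qed

text \<open>Dilation factors, complementary summands and vertex maps all add up.\<close>

lemma deformation_add:
  fixes P :: "'a::euclidean_space set"
  assumes P: "polytope P" and def: "deformation P Q1" "deformation P Q2"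
  shows "deformation P (Q1 + Q2)"
    and "edge_deformation_vector P Q1 v1 \<Longrightarrow> edge_deformation_vector P Q2 v2 \<Longrightarrow>
      edge_deformation_vector P (Q1 + Q2) (v1 + v2)"
proof -
  obtain l1 R1 where 1: "0 < l1" "(\<lambda>x. l1 *\<^sub>R x) ` P = Q1 + R1" "polytope R1" "R1 \<noteq> {}"
      "polytope Q1" "Q1 \<noteq> {}"
    using def(1) unfolding deformation_def by blast
  obtain l2 R2 where 2: "0 < l2" "(\<lambda>x. l2 *\<^sub>R x) ` P = Q2 + R2" "polytope R2" "R2 \<noteq> {}"
      "polytope Q2" "Q2 \<noteq> {}"
    using def(2) unfolding deformation_def by blast
  have dec: "(\<lambda>x. (l1 + l2) *\<^sub>R x) ` P = (Q1 + Q2) + (R1 + R2)"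
    using convex_scaleR_add_image[of P l1 l2] 1 2 P by (simp add: polytope_imp_convex add_ac)
  have "Q1 + Q2 \<noteq> {}" "R1 + R2 \<noteq> {}" "0 < l1 + l2" using 1 2 by (simp_all add: set_plus_nonempty)
  moreover have "polytope (Q1 + Q2)" "polytope (R1 + R2)" using 1 2 by (simp_all add: polytope_set_plus)
  ultimately show "deformation P (Q1 + Q2)" unfolding deformation_def using dec by blast
  assume v: "edge_deformation_vector P Q1 v1" "edge_deformation_vector P Q2 v2"
  obtain q1 where q1: "associated_vertices P Q1 q1" "edge_potential P q1 (Poly_Mapping.lookup v1)"
    using v(1) unfolding edge_deformation_vector_alt by blast
  obtain q2 where q2: "associated_vertices P Q2 q2" "edge_potential P q2 (Poly_Mapping.lookup v2)"
    using v(2) unfolding edge_deformation_vector_alt by blast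
  have "associated_vertices P (Q1 + Q2) (\<lambda>p. q1 p + q2 p)"
  proof (rule associated_verticesI[OF dec])
    show "0 < l1 + l2" using 1 2 by simp
    fix p assume p: "p extreme_point_of P"
    obtain y1 where y1: "y1 \<in> R1" "q1 p + y1 = l1 *\<^sub>R p"
      using associated_vertices_complement[OF P 1(2,1) q1(1) p] by blast
    obtain y2 where y2: "y2 \<in> R2" "q2 p + y2 = l2 *\<^sub>R p"
      using associated_vertices_complement[OF P 2(2,1) q2(1) p] by blast
    have "q1 p \<in> Q1" "q2 p \<in> Q2"
      using q1 q2 p unfolding associated_vertices_def extreme_point_of_def by blast+
    moreover have "q1 p + q2 p + (y1 + y2) = (l1 + l2) *\<^sub>R p"
      unfolding scaleR_add_left y1(2)[symmetric] y2(2)[symmetric] by (simp add: add_ac)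
    ultimately show "q1 p + q2 p \<in> Q1 + Q2 \<and> (\<exists>y\<in>R1 + R2. q1 p + q2 p + y = (l1 + l2) *\<^sub>R p)"
      using y1 y2 by blast
  qed
  moreover have "edge_potential P (\<lambda>p. q1 p + q2 p) (Poly_Mapping.lookup (v1 + v2))"
    using q1(2) q2(2) unfolding edge_potential_def
    by (simp add: lookup_add scaleR_add_left add_diff_add)
  moreover have "Poly_Mapping.keys (v1 + v2) \<subseteq> edges P"
    by (rule order_trans[OF keys_add]) (use v in \<open>simp add: edge_deformation_vector_def\<close>)
  ultimately show "edge_deformation_vector P (Q1 + Q2) (v1 + v2)"
    using v unfolding edge_deformation_vector_alt by (auto simp: lookup_add)
qed

lemma deformation_scale:
  fixes P :: "'a::euclidean_space set"
  assumes P: "polytope P" "P \<noteq> {}" and def: "deformation P Q" and m: "0 \<le> m"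
  shows "deformation P ((\<lambda>x. m *\<^sub>R x) ` Q)"
    and "edge_deformation_vector P Q v \<Longrightarrow> edge_deformation_vector P ((\<lambda>x. m *\<^sub>R x) ` Q) (m *\<^sub>R v)"
proof -
  let ?Q = "(\<lambda>x. m *\<^sub>R x) ` Q"
  obtain l R where 1: "0 < l" "(\<lambda>x. l *\<^sub>R x) ` P = Q + R" "polytope R" "R \<noteq> {}" "polytope Q" "Q \<noteq> {}"
    using def unfolding deformation_def by blast
  \<comment> \<open>For \<open>m = 0\<close> the factor \<open>m * l\<close> would not be positive.
    One extra copy of \<open>P\<close> in the complement turns it into
    \<open>m * l + 1\<close>.\<close>
  let ?R = "(\<lambda>x. m *\<^sub>R x) ` R + P" and ?l = "m * l + 1"
  have "(\<lambda>x. (m * l) *\<^sub>R x) ` P = ?Q + (\<lambda>x. m *\<^sub>R x) ` R"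
    unfolding scaleR_image_set_plus[symmetric] 1(2)[symmetric] by (simp add: image_image)
  moreover have "(\<lambda>x. ?l *\<^sub>R x) ` P = (\<lambda>x. (m * l) *\<^sub>R x) ` P + (\<lambda>x. 1 *\<^sub>R x) ` P"
    using convex_scaleR_add_image[of P "m * l" 1] 1 m P(1) by (simp add: polytope_imp_convex)
  ultimately have dec: "(\<lambda>x. ?l *\<^sub>R x) ` P = ?Q + ?R" by (simp add: add.assoc)
  have l: "0 < ?l" using m 1 by (simp add: add_nonneg_pos)
  have "?Q \<noteq> {}" "?R \<noteq> {}" using 1 P by (simp_all add: set_plus_nonempty)
  moreover have "polytope ?Q" "polytope ?R" using 1 P by (simp_all add: polytope_set_plus polytope_scaling)
  ultimately show "deformation P ?Q" unfolding deformation_def using dec l by blast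
  assume v: "edge_deformation_vector P Q v"
  obtain q where q: "associated_vertices P Q q" "edge_potential P q (Poly_Mapping.lookup v)"
    using v unfolding edge_deformation_vector_alt by blast
  have "associated_vertices P ?Q (\<lambda>p. m *\<^sub>R q p)"
  proof (rule associated_verticesI[OF dec l])
    fix p assume p: "p extreme_point_of P"
    obtain y where y: "y \<in> R" "q p + y = l *\<^sub>R p"
      using associated_vertices_complement[OF P(1) 1(2,1) q(1) p] by blast
    have "q p \<in> Q" "p \<in> P" using q p unfolding associated_vertices_def extreme_point_of_def by blast+
    moreover have "m *\<^sub>R q p + (m *\<^sub>R y + p) = ?l *\<^sub>R p"
      using arg_cong[OF y(2), of "\<lambda>z. m *\<^sub>R z"] by (simp add: algebra_simps)
    ultimately show "m *\<^sub>R q p \<in> ?Q \<and> (\<exists>y\<in>?R. m *\<^sub>R q p + y = ?l *\<^sub>R p)"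
      using y by blast
  qed
  moreover have "edge_potential P (\<lambda>p. m *\<^sub>R q p) (Poly_Mapping.lookup (m *\<^sub>R v))"
    using q(2) unfolding edge_potential_def by (simp flip: scaleR_diff_right)
  moreover have "Poly_Mapping.keys (m *\<^sub>R v) \<subseteq> edges P"
    using v unfolding edge_deformation_vector_def by (auto simp: in_keys_iff subset_iff)
  ultimately show "edge_deformation_vector P ?Q (m *\<^sub>R v)"
    using v m unfolding edge_deformation_vector_alt by auto
qed

lemma deformation_translation:
  fixes P :: "'a::euclidean_space set"
  assumes "polytope P" "P \<noteq> {}" "deformation P Q"
  shows "deformation P ((+) t ` Q)"
    and "edge_deformation_vector P Q v \<Longrightarrow> edge_deformation_vector P ((+) t ` Q) v"
proof -
  have "(+) t ` Q = {t} + Q" by (auto simp: set_plus_def)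
  then show "deformation P ((+) t ` Q)"
    "edge_deformation_vector P Q v \<Longrightarrow> edge_deformation_vector P ((+) t ` Q) v"
    using deformation_add[OF assms(1) deformation_singleton(1)[OF assms(1,2)] assms(3), of t]
      deformation_singleton(2)[OF assms(1,2)] by fastforce+
qed

lemma deformation_sum:
  fixes P :: "'a::euclidean_space set"
  assumes "polytope P" "P \<noteq> {}" "finite I"
    and "\<And>i. i \<in> I \<Longrightarrow> deformation P (Q i)" "\<And>i. i \<in> I \<Longrightarrow> edge_deformation_vector P (Q i) (v i)"
  shows "deformation P (\<Sum>i\<in>I. Q i)" "edge_deformation_vector P (\<Sum>i\<in>I. Q i) (\<Sum>i\<in>I. v i)"
  using assms(3-5)
proof (induction I)
  case empty
  {
    case 1 show ?case using deformation_singleton(1)[OF assms(1,2), of 0] by simp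
  next
    case 2 show ?case using deformation_singleton(2)[OF assms(1,2), of 0] by simp
  }
next
  case (insert i I)
  {
    case 1
    show ?case using insert 1 deformation_add(1)[OF assms(1)] by simp
  next
    case 2
    show ?case using insert 2 deformation_add(2)[OF assms(1)] by simp
  }
qed

text \<open>Allows the summands of a deformation to be measured by vectors on the edges of
  \<open>P\<close>.\<close>

lemma deformation_trans:
  fixes P :: "'a::euclidean_space set"
  assumes "deformation P Q" "deformation Q S"
  shows "deformation P S"
proof -
  obtain l R where 1: "0 < l" "(\<lambda>x. l *\<^sub>R x) ` P = Q + R" "polytope R" "R \<noteq> {}"
    using assms(1) unfolding deformation_def by blast
  obtain m T where 2: "0 < m" "(\<lambda>x. m *\<^sub>R x) ` Q = S + T" "polytope T" "T \<noteq> {}" "polytope S" "S \<noteq> {}"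
    using assms(2) unfolding deformation_def by blast
  let ?T = "T + (\<lambda>x. m *\<^sub>R x) ` R"
  have "(\<lambda>x. (m * l) *\<^sub>R x) ` P = (\<lambda>x. m *\<^sub>R x) ` (\<lambda>x. l *\<^sub>R x) ` P" by (simp add: image_image)
  also have "\<dots> = S + ?T" unfolding 1(2) scaleR_image_set_plus 2(2) by (simp add: add.assoc)
  finally have "(\<lambda>x. (m * l) *\<^sub>R x) ` P = S + ?T" .
  moreover have "?T \<noteq> {}" "0 < m * l" using 1 2 by (simp_all add: set_plus_nonempty)
  moreover have "polytope ?T" using 1 2 by (simp add: polytope_set_plus polytope_scaling)
  ultimately show ?thesis unfolding deformation_def using 2 by blast
qed

text \<open>The values of \<open>q\<close> exhaust the vertices of \<open>Q\<close>: if
  \<open>c\<close> exposes a vertex \<open>y\<close> of \<open>Q\<close> and \<open>p\<close> is a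
  vertex of \<open>P\<close> maximizing \<open>c\<close>, then \<open>q p\<close> maximizes
  \<open>c\<close> on \<open>Q\<close> and equals \<open>y\<close>.\<close>

lemma deformation_hull:
  fixes P :: "'a::euclidean_space set"
  assumes P: "polytope P" "P \<noteq> {}" and def: "deformation P Q" and q: "associated_vertices P Q q"
  shows "Q = convex hull (q ` {p. p extreme_point_of P})"
proof
  have Q: "polytope Q" using def deformation_def by blast
  have sub: "q ` {p. p extreme_point_of P} \<subseteq> Q"
    using q unfolding associated_vertices_def extreme_point_of_def by blast
  show "convex hull (q ` {p. p extreme_point_of P}) \<subseteq> Q"
    using sub Q by (intro hull_minimal) (auto simp: polytope_imp_convex)
  have "y \<in> q ` {p. p extreme_point_of P}" if y: "y extreme_point_of Q" for y
  proof -
    obtain c where c: "\<And>z. z \<in> Q \<Longrightarrow> z \<noteq> y \<Longrightarrow> c \<bullet> z < c \<bullet> y"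
      using polytope_extreme_exposed Q y by blast
    obtain p where p: "p extreme_point_of P" "\<And>x. x \<in> P \<Longrightarrow> c \<bullet> x \<le> c \<bullet> p"
      using polytope_extreme_maximum P by metis
    then have "c \<in> normal_cone P {p}" by (simp add: normal_cone_singleton)
    then have "c \<bullet> y \<le> c \<bullet> q p"
      using q p y unfolding associated_vertices_def normal_cone_def extreme_point_of_def by blast
    then have "q p = y" using c[of "q p"] sub p(1) by force
    then show ?thesis using p(1) by blast
  qed
  then have "{y. y extreme_point_of Q} \<subseteq> q ` {p. p extreme_point_of P}" by blast
  then have "convex hull {y. y extreme_point_of Q} \<subseteq> convex hull (q ` {p. p extreme_point_of P})"
    by (rule hull_mono)
  then show "Q \<subseteq> convex hull (q ` {p. p extreme_point_of P})"
    using polytope_hull_extreme[OF Q] by simp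
qed

text \<open>The two vertex maps have equal differences along every edge, so their difference is
  constant along paths to the top vertex \<open>p\<close>, hence everywhere.\<close>

lemma deformation_unique:
  fixes P :: "'a::euclidean_space set"
  assumes P: "polytope P" "P \<noteq> {}" and def: "deformation P Q" "deformation P Q'"
    and v: "edge_deformation_vector P Q v" "edge_deformation_vector P Q' v"
  obtains t where "Q' = (+) t ` Q"
proof -
  obtain q where q: "associated_vertices P Q q" "edge_potential P q (Poly_Mapping.lookup v)"
    using v(1) unfolding edge_deformation_vector_alt by blast
  obtain q' where q': "associated_vertices P Q' q'" "edge_potential P q' (Poly_Mapping.lookup v)"
    using v(2) unfolding edge_deformation_vector_alt by blast
  obtain p where p: "p extreme_point_of P" using polytope_extreme_exists P by blast
  obtain d where d: "\<And>x. x \<in> P \<Longrightarrow> x \<noteq> p \<Longrightarrow> d \<bullet> x < d \<bullet> p"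
    using polytope_extreme_exposed P(1) p by blast
  have pP: "p \<in> P" using p extreme_point_of_def by blast
  define t where "t = q' p - q p"
  have *: "q' w = t + q w" if "w extreme_point_of P" for w
    using P(1) that pP
  proof (induction rule: monotone_path_induct[where d = d])
    case (step w w')
    have "q w - q w' = q' w - q' w'" using q(2) q'(2) step(1) unfolding edge_potential_def by metis
    then show ?case using step(3) by (metis add.commute add_diff_cancel_left' diff_add_cancel diff_diff_eq2 diff_eq_eq)
  qed (use d in \<open>auto simp: t_def\<close>)
  have "Q' = convex hull (q' ` {p. p extreme_point_of P})"
    using deformation_hull[OF P def(2) q'(1)] .
  also have "q' ` {p. p extreme_point_of P} = (+) t ` q ` {p. p extreme_point_of P}"
    using * by (auto simp: image_image intro!: image_cong)
  also have "convex hull \<dots> = (+) t ` Q"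
    unfolding convex_hull_translation deformation_hull[OF P def(1) q(1), symmetric] ..
  finally show ?thesis using that by blast
qed

text \<open>
  Shephard's criterion. Along an edge path increasing for \<open>c\<close> the values of \<open>c\<close> at the points \<open>q p\<close>
  do not decrease; a perturbation of \<open>c\<close> makes the vertex where all paths end unique.
\<close>

lemma edge_potential_maximum:
  fixes P :: "'a::euclidean_space set"
  assumes P: "polytope P" and pot: "edge_potential P q l" and l: "\<And>e. e \<in> edges P \<Longrightarrow> 0 \<le> l e"
    and p: "p extreme_point_of P" "\<And>x. x \<in> P \<Longrightarrow> c \<bullet> x \<le> c \<bullet> p" and w: "w extreme_point_of P"
  shows "c \<bullet> q w \<le> c \<bullet> q p"
proof (rule ccontr)
  assume "\<not> c \<bullet> q w \<le> c \<bullet> q p"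
  then have gt: "0 < c \<bullet> q w - c \<bullet> q p" by simp
  obtain a where a: "\<And>x. x \<in> P \<Longrightarrow> x \<noteq> p \<Longrightarrow> a \<bullet> x < a \<bullet> p"
    using polytope_extreme_exposed P p(1) by blast
  \<comment> \<open>So small that the perturbed functional \<open>d\<close> still takes a larger
    value at \<open>q w\<close> than at \<open>q p\<close>.\<close>
  obtain \<epsilon> where eps: "0 < \<epsilon>" "\<epsilon> * (a \<bullet> q p - a \<bullet> q w) < c \<bullet> q w - c \<bullet> q p"
    using small_perturbation[of "{w}" "\<lambda>_. c \<bullet> q w - c \<bullet> q p" "\<lambda>_. a \<bullet> q p - a \<bullet> q w"] gt by auto
  define d where "d = c + \<epsilon> *\<^sub>R a"
  have dx: "d \<bullet> x = c \<bullet> x + \<epsilon> * (a \<bullet> x)" for x by (simp add: d_def inner_add_left)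
  have pP: "p \<in> P" using p extreme_point_of_def by blast
  have "d \<bullet> q w \<le> d \<bullet> q p"
    using P w pP
  proof (induction rule: monotone_path_induct[where d = d])
    case (unique_max x)
    then have "\<epsilon> * (a \<bullet> x) < \<epsilon> * (a \<bullet> p)" using a eps by simp
    then show ?case using p(2)[OF unique_max(1)] by (simp add: dx)
  next
    case (step w w')
    have "q w - q w' = l (closed_segment w w') *\<^sub>R (w - w')"
      using pot step(1) unfolding edge_potential_def by blast
    then have "d \<bullet> q w - d \<bullet> q w' = l (closed_segment w w') * (d \<bullet> w - d \<bullet> w')"
      by (metis inner_diff_right inner_scaleR_right)
    moreover have "\<dots> \<le> 0"
      using l[of "closed_segment w w'"] step(1,2) by (intro mult_nonneg_nonpos) (auto simp: edges_def)
    ultimately show ?case using step(3) by linarith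
  qed simp
  then show False using eps(2) unfolding dx by (simp add: algebra_simps)
qed

text \<open>The complementary summand comes from the complementary potential
  \<open>L *\<^sub>R p - q p\<close>, whose scalars \<open>L - ?f e\<close> are nonnegative once
  \<open>L\<close> is large. By the maximum property both hulls are maximized at the images of the
  same vertex, so their sum is the dilated \<open>P\<close>.\<close>

lemma deformation_of_edge_potential:
  fixes P :: "'a::euclidean_space set"
  assumes P: "polytope P" "P \<noteq> {}" and pot: "edge_potential P q (Poly_Mapping.lookup v)"
    and v: "\<And>e. e \<in> edges P \<Longrightarrow> 0 \<le> Poly_Mapping.lookup v e" "Poly_Mapping.keys v \<subseteq> edges P"
  obtains Q where "deformation P Q" "edge_deformation_vector P Q v"
proof -
  let ?f = "Poly_Mapping.lookup v" and ?V = "{p. p extreme_point_of P}"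
  \<comment> \<open>The sum bounds every single entry of \<open>v\<close>; the 1 makes
    \<open>L\<close> positive even if all entries vanish.\<close>
  define L where "L = 1 + (\<Sum>e\<in>edges P. ?f e)"
  have L: "0 < L" "?f e \<le> L" if "e \<in> edges P \<or> e = e" for e
  proof -
    have nn: "0 \<le> (\<Sum>e\<in>edges P. ?f e)" using v by (simp add: sum_nonneg)
    then show "0 < L" by (simp add: L_def)
    show "?f e \<le> L"
    proof (cases "e \<in> edges P")
      case True
      then have "?f e \<le> (\<Sum>e\<in>edges P. ?f e)"
        using finite_edges P(1) v by (intro member_le_sum) auto
      then show ?thesis by (simp add: L_def)
    next
      case False
      then have "?f e = 0" using v(2) by (auto simp: in_keys_iff)
      then show ?thesis using nn by (simp add: L_def)
    qed
  qed
  have Lpos: "0 < L" using L by blast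
  define r where "r = (\<lambda>p. L *\<^sub>R p - q p)"
  have potr: "edge_potential P r (\<lambda>e. L - ?f e)"
    unfolding edge_potential_def
  proof (intro allI impI)
    fix z w assume "adjacent P z w"
    then have "q z - q w = ?f (closed_segment z w) *\<^sub>R (z - w)" using pot unfolding edge_potential_def by blast
    moreover have "r z - r w = L *\<^sub>R (z - w) - (q z - q w)" by (simp add: r_def algebra_simps)
    ultimately show "r z - r w = (L - ?f (closed_segment z w)) *\<^sub>R (z - w)" by (simp add: scaleR_diff_left)
  qed
  define Q where "Q = convex hull (q ` ?V)"
  define R where "R = convex hull (r ` ?V)"
  have fin: "finite ?V" using polytope_extreme_finite P(1) .
  have poly: "polytope Q" "polytope R"
    unfolding Q_def R_def using fin by (auto intro: polytope_convex_hull)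
  have ne: "Q \<noteq> {}" "R \<noteq> {}" unfolding Q_def R_def using polytope_extreme_exists[OF P] by auto
  have mem: "q p \<in> Q" "r p \<in> R" if "p extreme_point_of P" for p
    unfolding Q_def R_def using that by (auto intro: hull_inc)
  have bound: "c \<bullet> x \<le> c \<bullet> s p"
    if "edge_potential P s g" "\<And>e. e \<in> edges P \<Longrightarrow> 0 \<le> g e" "x \<in> convex hull (s ` ?V)"
      "p extreme_point_of P" "\<And>x. x \<in> P \<Longrightarrow> c \<bullet> x \<le> c \<bullet> p" for s g x c p
  proof -
    have "s ` ?V \<subseteq> {x. c \<bullet> x \<le> c \<bullet> s p}"
      using edge_potential_maximum[OF P(1) that(1,2,4,5)] by auto
    then have "convex hull (s ` ?V) \<subseteq> {x. c \<bullet> x \<le> c \<bullet> s p}"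
      by (intro hull_minimal) (auto simp: convex_halfspace_le)
    then show ?thesis using that(3) by blast
  qed
  have dec: "(\<lambda>x. L *\<^sub>R x) ` P = Q + R"
  proof
    have "(\<lambda>x. L *\<^sub>R x) ` P = convex hull ((\<lambda>x. L *\<^sub>R x) ` ?V)"
      using polytope_hull_extreme[OF P(1)] convex_hull_scaling[of L ?V] by simp
    also have "\<dots> \<subseteq> Q + R"
    proof (rule hull_minimal)
      show "convex (Q + R)" using poly by (intro convex_set_plus polytope_imp_convex)
      have "q p + r p = L *\<^sub>R p" for p by (simp add: r_def)
      then show "(\<lambda>x. L *\<^sub>R x) ` ?V \<subseteq> Q + R" using mem by (metis (mono_tags, lifting) image_subsetI mem_Collect_eq set_plus_intro)
    qed
    finally show "(\<lambda>x. L *\<^sub>R x) ` P \<subseteq> Q + R" .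
    show "Q + R \<subseteq> (\<lambda>x. L *\<^sub>R x) ` P"
    proof
      fix z assume "z \<in> Q + R"
      then obtain x y where xy: "x \<in> Q" "y \<in> R" "z = x + y" by (auto simp: set_plus_def)
      show "z \<in> (\<lambda>x. L *\<^sub>R x) ` P"
      proof (rule ccontr)
        assume "z \<notin> (\<lambda>x. L *\<^sub>R x) ` P"
        moreover have "polytope ((\<lambda>x. L *\<^sub>R x) ` P)" using P(1) by (rule polytope_scaling)
        \<comment> \<open>The separating functional is smaller at \<open>z\<close> than on the
          dilated \<open>P\<close>, so the maximum property is applied to
          \<open>- a\<close>.\<close>
        ultimately obtain a b where ab: "a \<bullet> z < b" "\<forall>x\<in>(\<lambda>x. L *\<^sub>R x) ` P. b < a \<bullet> x"
          using separating_hyperplane_closed_point polytope_imp_convex polytope_imp_closed by metis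
        obtain p where p: "p extreme_point_of P" "\<And>x. x \<in> P \<Longrightarrow> (- a) \<bullet> x \<le> (- a) \<bullet> p"
          using polytope_extreme_maximum[OF P] by metis
        have "(- a) \<bullet> x \<le> (- a) \<bullet> q p"
          using xy(1) p v(1) unfolding Q_def by (intro bound[OF pot]) auto
        moreover have "(- a) \<bullet> y \<le> (- a) \<bullet> r p"
          using xy(2) p L(2) unfolding R_def by (intro bound[OF potr]) auto
        ultimately have "a \<bullet> (L *\<^sub>R p) \<le> a \<bullet> z"
          unfolding xy(3) by (simp add: r_def algebra_simps inner_diff_right)
        moreover have "b < a \<bullet> (L *\<^sub>R p)" using ab(2) p(1) unfolding extreme_point_of_def by blast
        ultimately show False using ab(1) by linarith
      qed
    qed
  qed
  have "deformation P Q" unfolding deformation_def using dec poly ne Lpos by blast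
  moreover have "associated_vertices P Q q"
  proof (rule associated_verticesI[OF dec Lpos])
    fix p assume "p extreme_point_of P"
    moreover have "q p + r p = L *\<^sub>R p" by (simp add: r_def)
    ultimately show "q p \<in> Q \<and> (\<exists>y\<in>R. q p + y = L *\<^sub>R p)" using mem by blast
  qed
  then have "edge_deformation_vector P Q v"
    unfolding edge_deformation_vector_alt using v pot by blast
  ultimately show ?thesis using that by blast
qed

text \<open>Finitely many hyperplanes through 0 form a null set and cannot cover the space.\<close>

lemma generic_functional:
  fixes S :: "'a::euclidean_space set"
  assumes "finite S" "0 \<notin> S"
  shows "\<exists>c. \<forall>s\<in>S. c \<bullet> s \<noteq> 0"
proof -
  have "negligible (\<Union>s\<in>S. {c. s \<bullet> c = 0})"
    using assms by (intro negligible_Union) (auto intro!: negligible_hyperplane)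
  then have "(\<Union>s\<in>S. {c. s \<bullet> c = 0}) \<noteq> UNIV" using non_negligible_UNIV by metis
  then obtain c where "c \<notin> (\<Union>s\<in>S. {c. s \<bullet> c = 0})" by blast
  then show ?thesis by (auto simp: inner_commute intro!: exI[of _ c])
qed

text \<open>
  The potential is built downwards along a functional \<open>c\<close> that separates the vertices. At a new
  vertex \<open>p\<close> the values prescribed by the edges going up from \<open>p\<close> agree, since they agree for two
  edges in a common \<open>2\<close>-face and these connect all upper neighbours.
\<close>

lemma edge_potential_exists:
  fixes P :: "'a::euclidean_space set"
  assumes P: "polytope P"
    and faces: "\<And>F. F face_of P \<Longrightarrow> aff_dim F = 2 \<Longrightarrow> 2 simplex F \<or> parallelogram F"
    and l: "\<And>e f. edge_step P e f \<Longrightarrow> l e = l f"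
  obtains q where "edge_potential P q l"
proof -
  let ?V = "{p. p extreme_point_of P}"
  have fin: "finite ?V" using polytope_extreme_finite P .
  \<comment> \<open>A functional that vanishes on no nonzero difference of vertices takes distinct
    values at distinct vertices.\<close>
  define D where "D = (\<lambda>(z, w). z - w) ` (?V \<times> ?V) - {0}"
  have "finite D" "0 \<notin> D" unfolding D_def using fin by auto
  then obtain c where c: "\<forall>s\<in>D. c \<bullet> s \<noteq> 0"
    using generic_functional by blast
  have inj: "z = w" if "z \<in> ?V" "w \<in> ?V" "c \<bullet> z = c \<bullet> w" for z w
  proof (rule ccontr)
    assume "z \<noteq> w"
    then have "z - w \<in> D" using that unfolding D_def by force
    then show False using c that(3) by (auto simp: inner_diff_right)
  qed
  \<comment> \<open>The domains of partial potentials: sets of vertices closed under going up.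
    Removing the lowest vertex gives such a set again, which drives the induction on the
    cardinality.\<close>
  define upper where "upper U \<longleftrightarrow> U \<subseteq> ?V \<and> (\<forall>z\<in>U. \<forall>w\<in>?V. c \<bullet> z < c \<bullet> w \<longrightarrow> w \<in> U)" for U
  define pot where "pot U q \<longleftrightarrow> (\<forall>z\<in>U. \<forall>w\<in>U. adjacent P z w \<longrightarrow>
      q z - q w = l (closed_segment z w) *\<^sub>R (z - w))" for U q
  have main: "\<exists>q. pot U q" if "upper U" "card U = n" for U n
    using that
  proof (induction n arbitrary: U)
    case 0
    then have "U = {}" using fin finite_subset unfolding upper_def by fastforce
    then show ?case by (simp add: pot_def)
  next
    case (Suc n)
    have finU: "finite U" using Suc.prems fin finite_subset unfolding upper_def by blast
    have "U \<noteq> {}" using Suc.prems by auto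
    with finU have "Min ((\<bullet>) c ` U) \<in> (\<bullet>) c ` U" by (intro Min_in) auto
    then obtain p where p: "p \<in> U" "c \<bullet> p = Min ((\<bullet>) c ` U)" by (metis imageE)
    have min: "c \<bullet> p \<le> c \<bullet> z" if "z \<in> U" for z using that finU unfolding p(2) by simp
    define U' where "U' = U - {p}"
    have UV: "U \<subseteq> ?V" using Suc.prems by (simp add: upper_def)
    have U': "z \<in> U' \<longleftrightarrow> z \<in> ?V \<and> c \<bullet> p < c \<bullet> z" for z
    proof
      assume z: "z \<in> U'"
      then have "c \<bullet> p \<le> c \<bullet> z" "c \<bullet> p \<noteq> c \<bullet> z" using min[of z] inj[of p z] p(1) UV unfolding U'_def by blast+
      then show "z \<in> ?V \<and> c \<bullet> p < c \<bullet> z" using z UV unfolding U'_def by auto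
    next
      assume "z \<in> ?V \<and> c \<bullet> p < c \<bullet> z"
      then show "z \<in> U'" using Suc.prems(1) p(1) unfolding upper_def U'_def by blast
    qed
    have "upper U'" unfolding upper_def using U' by (auto intro: order_less_trans)
    moreover have "card U' = n" using Suc.prems(2) p(1) finU unfolding U'_def by simp
    ultimately obtain q where q: "pot U' q" using Suc.IH by blast
    have qU': "q z - q w = l (closed_segment z w) *\<^sub>R (z - w)"
      if "adjacent P z w" "c \<bullet> p < c \<bullet> z" "c \<bullet> p < c \<bullet> w" for z w
      using q that adjacent_extreme[OF that(1)] U' unfolding pot_def by blast
    \<comment> \<open>The value at \<open>p\<close> that the edge to an upper neighbour
      \<open>x\<close> prescribes.\<close>
    define val where "val x = q x + l (closed_segment p x) *\<^sub>R (p - x)" for x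
    have agree: "val x = val y"
      if "adjacent P p x" "adjacent P p y" "c \<bullet> p < c \<bullet> x" "c \<bullet> p < c \<bullet> y" for x y
      using P that
    proof (rule upper_neighbours_connected)
      fix F x y
      assume F: "F face_of P" "aff_dim F = 2"
        and xy: "adjacent P p x" "adjacent P p y" "closed_segment p x \<subseteq> F" "closed_segment p y \<subseteq> F"
          "c \<bullet> p < c \<bullet> x" "c \<bullet> p < c \<bullet> y"
      show "val x = val y"
        unfolding val_def
        using potential_at_corner[OF F faces[OF F] xy(1,3,5,2,4,6) l qU'] by blast
    qed
    \<comment> \<open>At the top vertex there is no upper neighbour, and \<open>k\<close> is
      arbitrary; this is the freedom of translation.\<close>
    obtain k where k: "\<And>x. adjacent P p x \<Longrightarrow> c \<bullet> p < c \<bullet> x \<Longrightarrow> val x = k"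
      using agree by metis
    have new: "k - q w = l (closed_segment p w) *\<^sub>R (p - w)" if "w \<in> U'" "adjacent P p w" for w
    proof -
      have "val w = k" using k that U'[of w] by blast
      then show ?thesis unfolding val_def by (metis add_diff_cancel_left')
    qed
    have "pot U (q(p := k))"
      unfolding pot_def
    proof (intro ballI impI)
      fix z w assume zw: "z \<in> U" "w \<in> U" "adjacent P z w"
      then have ne: "z \<noteq> w" using adjacent_neq by blast
      consider "z = p" "w \<in> U'" | "w = p" "z \<in> U'" | "z \<in> U'" "w \<in> U'"
        using zw ne unfolding U'_def by blast
      then show "(q(p := k)) z - (q(p := k)) w = l (closed_segment z w) *\<^sub>R (z - w)"
      proof cases
        case 1 then show ?thesis using new zw ne by auto
      next
        case 2
        then have "k - q z = l (closed_segment p z) *\<^sub>R (p - z)" using new zw adjacent_sym by blast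
        then have "q z - k = l (closed_segment p z) *\<^sub>R (z - p)" by (metis minus_diff_eq scaleR_minus_right)
        then show ?thesis using 2 ne by (auto simp: closed_segment_commute)
      next
        case 3
        then show ?thesis using q zw(3) unfolding pot_def U'_def by auto
      qed
    qed
    then show ?case by blast
  qed
  have "upper ?V" by (simp add: upper_def)
  then obtain q where "pot ?V q" using main by blast
  then have "edge_potential P q l"
    unfolding edge_potential_def pot_def using adjacent_extreme by blast
  then show ?thesis using that by blast
qed

section \<open>Cones of vectors constant on classes\<close>

lemma convex_cone_hull_singleton:
  "convex_cone hull {x :: 'a::real_vector} = {c *\<^sub>R x |c. 0 \<le> c}"
proof
  have "convex_cone {c *\<^sub>R x |c. 0 \<le> c}"
    unfolding convex_cone_iff
  proof (intro conjI ballI allI impI)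
    show "0 \<in> {c *\<^sub>R x |c. 0 \<le> c}" by (auto intro!: exI[of _ "0::real"])
  next
    fix y z assume "y \<in> {c *\<^sub>R x |c. 0 \<le> c}" "z \<in> {c *\<^sub>R x |c. 0 \<le> c}"
    then obtain a b where "y = a *\<^sub>R x" "z = b *\<^sub>R x" "0 \<le> a" "0 \<le> b" by blast
    then show "y + z \<in> {c *\<^sub>R x |c. 0 \<le> c}" by (auto simp flip: scaleR_add_left intro!: exI[of _ "a + b"])
  next
    fix y and k :: real assume "y \<in> {c *\<^sub>R x |c. 0 \<le> c}" "0 \<le> k"
    then obtain a where "y = a *\<^sub>R x" "0 \<le> a" by blast
    then show "k *\<^sub>R y \<in> {c *\<^sub>R x |c. 0 \<le> c}" using \<open>0 \<le> k\<close> by (auto intro!: exI[of _ "k * a"])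
  qed
  moreover have "x \<in> {c *\<^sub>R x |c. 0 \<le> c}" by (auto intro!: exI[of _ "1::real"])
  ultimately show "convex_cone hull {x} \<subseteq> {c *\<^sub>R x |c. 0 \<le> c}" by (intro hull_minimal) auto
  show "{c *\<^sub>R x |c. 0 \<le> c} \<subseteq> convex_cone hull {x}"
    by (auto intro: convex_cone_hull_mul hull_inc)
qed

text \<open>Pure linear algebra, independent of polytopes; \<open>E\<close> and \<open>K\<close>
  become the edges of \<open>P\<close> and their classes.\<close>

locale edge_partition =
  fixes E :: "'b set" and K :: "'b set set"
  assumes finite_E: "finite E" and partition: "partition_on E K"
begin

definition "constant_cone = {v :: 'b \<Rightarrow>\<^sub>0 real. Poly_Mapping.keys v \<subseteq> E \<and>
  (\<forall>e\<in>E. 0 \<le> Poly_Mapping.lookup v e) \<and>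
  (\<forall>C\<in>K. \<forall>e\<in>C. \<forall>f\<in>C. Poly_Mapping.lookup v e = Poly_Mapping.lookup v f)}"

lemma constant_coneI:
  assumes "Poly_Mapping.keys v \<subseteq> E"
    "\<And>C e f. C \<in> K \<Longrightarrow> e \<in> C \<Longrightarrow> f \<in> C \<Longrightarrow> Poly_Mapping.lookup v e = Poly_Mapping.lookup v f"
    "\<And>e. e \<in> E \<Longrightarrow> 0 \<le> Poly_Mapping.lookup v e"
  shows "v \<in> constant_cone"
  using assms unfolding constant_cone_def by blast

lemma constant_coneD:
  assumes "v \<in> constant_cone"
  shows "Poly_Mapping.keys v \<subseteq> E" "e \<in> E \<Longrightarrow> 0 \<le> Poly_Mapping.lookup v e"
    "C \<in> K \<Longrightarrow> e \<in> C \<Longrightarrow> f \<in> C \<Longrightarrow> Poly_Mapping.lookup v e = Poly_Mapping.lookup v f"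
  using assms unfolding constant_cone_def by blast+

lemma finite_K: "finite K"
  using finite_elements finite_E partition by blast

lemma class_subset: "C \<in> K \<Longrightarrow> C \<subseteq> E"
  using partition by (auto simp: partition_on_def)

lemma class_nonempty: "C \<in> K \<Longrightarrow> C \<noteq> {}"
  using partition by (auto simp: partition_on_def)

lemma class_unique: "C \<in> K \<Longrightarrow> C' \<in> K \<Longrightarrow> e \<in> C \<Longrightarrow> e \<in> C' \<Longrightarrow> C = C'"
  using partition unfolding partition_on_def disjoint_def by blast

lemma class_exists: "e \<in> E \<Longrightarrow> \<exists>C\<in>K. e \<in> C"
  using partition by (auto simp: partition_on_def)

lemma lookup_class: "C \<in> K \<Longrightarrow> Poly_Mapping.lookup (char_vector C) e = (if e \<in> C then 1 else 0)"
  using lookup_char_vector class_subset finite_E finite_subset by metis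

lemma lookup_combination:
  assumes "C \<in> K" "e \<in> C"
  shows "Poly_Mapping.lookup (\<Sum>D\<in>K. t D *\<^sub>R char_vector D) e = t C"
proof -
  have "Poly_Mapping.lookup (\<Sum>D\<in>K. t D *\<^sub>R char_vector D) e
      = (\<Sum>D\<in>K. t D *\<^sub>R Poly_Mapping.lookup (char_vector D) e)"
    by (simp add: lookup_sum)
  also have "\<dots> = (\<Sum>D\<in>K. if D = C then t D else 0)"
    using assms class_unique by (intro sum.cong) (auto simp: lookup_class)
  finally show ?thesis using assms(1) finite_K by simp
qed

lemma lookup_combination_outside:
  "e \<notin> E \<Longrightarrow> Poly_Mapping.lookup (\<Sum>D\<in>K. t D *\<^sub>R char_vector D) e = 0"
  by (auto simp: lookup_sum lookup_class intro!: sum.neutral dest: subsetD[OF class_subset])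

lemma char_vector_class_mem:
  assumes C: "C \<in> K"
  shows "char_vector C \<in> constant_cone"
proof -
  have "Poly_Mapping.keys (char_vector C) \<subseteq> E"
    using subsetD[OF class_subset[OF C]] by (auto simp: in_keys_iff lookup_class[OF C] split: if_splits)
  moreover have "Poly_Mapping.lookup (char_vector C) e = Poly_Mapping.lookup (char_vector C) f"
    if "D \<in> K" "e \<in> D" "f \<in> D" for D e f
  proof -
    have "e \<in> C \<longleftrightarrow> f \<in> C" using class_unique[OF C that(1)] that by blast
    then show ?thesis by (simp add: lookup_class[OF C])
  qed
  moreover have "0 \<le> Poly_Mapping.lookup (char_vector C) e" for e by (simp add: lookup_class[OF C])
  ultimately show ?thesis unfolding constant_cone_def by blast
qed

lemma convex_cone_constant_cone: "convex_cone constant_cone"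
  unfolding convex_cone_iff
proof (intro conjI ballI allI impI)
  show "0 \<in> constant_cone" by (simp add: constant_cone_def)
next
  fix x y assume xy: "x \<in> constant_cone" "y \<in> constant_cone"
  have "Poly_Mapping.keys (x + y) \<subseteq> E"
    by (rule order_trans[OF keys_add]) (use xy in \<open>simp add: constant_cone_def\<close>)
  moreover have "Poly_Mapping.lookup (x + y) e = Poly_Mapping.lookup (x + y) f"
    if "C \<in> K" "e \<in> C" "f \<in> C" for C e f
    unfolding lookup_add constant_coneD(3)[OF xy(1) that] constant_coneD(3)[OF xy(2) that] ..
  moreover have "0 \<le> Poly_Mapping.lookup (x + y) e" if "e \<in> E" for e
    using constant_coneD(2)[OF xy(1) that] constant_coneD(2)[OF xy(2) that] by (simp add: lookup_add)
  ultimately show "x + y \<in> constant_cone" by (rule constant_coneI)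
next
  fix x and c :: real assume x: "x \<in> constant_cone" "0 \<le> c"
  have "Poly_Mapping.keys (c *\<^sub>R x) \<subseteq> E"
    by (rule order_trans[OF _ constant_coneD(1)[OF x(1)]]) (auto simp: in_keys_iff)
  moreover have "Poly_Mapping.lookup (c *\<^sub>R x) e = Poly_Mapping.lookup (c *\<^sub>R x) f"
    if "C \<in> K" "e \<in> C" "f \<in> C" for C e f
    unfolding lookup_scaleR constant_coneD(3)[OF x(1) that] ..
  moreover have "0 \<le> Poly_Mapping.lookup (c *\<^sub>R x) e" if "e \<in> E" for e
    using constant_coneD(2)[OF x(1) that] x(2) by simp
  ultimately show "c *\<^sub>R x \<in> constant_cone" by (rule constant_coneI)
qed

lemma constant_cone_combination:
  assumes "v \<in> constant_cone"
  shows "\<exists>t. (\<forall>C\<in>K. 0 \<le> t C) \<and> v = (\<Sum>C\<in>K. t C *\<^sub>R char_vector C) \<and>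
    (\<forall>C\<in>K. \<forall>e\<in>C. Poly_Mapping.lookup v e = t C)"
proof -
  define t where "t C = Poly_Mapping.lookup v (SOME e. e \<in> C)" for C
  have some: "(SOME e. e \<in> C) \<in> C" if "C \<in> K" for C using class_nonempty[OF that] some_in_eq by blast
  have t: "Poly_Mapping.lookup v e = t C" if "C \<in> K" "e \<in> C" for C e
    unfolding t_def by (rule constant_coneD(3)[OF assms that some[OF that(1)]])
  have nonneg: "0 \<le> t C" if "C \<in> K" for C
    unfolding t_def by (rule constant_coneD(2)[OF assms subsetD[OF class_subset[OF that] some[OF that]]])
  have "v = (\<Sum>C\<in>K. t C *\<^sub>R char_vector C)"
  proof (rule poly_mapping_eqI)
    fix e
    show "Poly_Mapping.lookup v e = Poly_Mapping.lookup (\<Sum>C\<in>K. t C *\<^sub>R char_vector C) e"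
    proof (cases "e \<in> E")
      case True
      then obtain C where "C \<in> K" "e \<in> C" using class_exists by blast
      then show ?thesis using t lookup_combination by simp
    next
      case False
      then have "Poly_Mapping.lookup v e = 0" using constant_coneD(1)[OF assms] by (auto simp: in_keys_iff)
      then show ?thesis using lookup_combination_outside[OF False] by simp
    qed
  qed
  then show ?thesis using t nonneg by blast
qed

lemma constant_cone_eq_hull: "constant_cone = convex_cone hull (char_vector ` K)"
proof
  show "convex_cone hull (char_vector ` K) \<subseteq> constant_cone"
    using char_vector_class_mem convex_cone_constant_cone by (intro hull_minimal) auto
  show "constant_cone \<subseteq> convex_cone hull (char_vector ` K)"
  proof
    fix v assume "v \<in> constant_cone"
    then obtain t where t: "\<forall>C\<in>K. 0 \<le> t C" "v = (\<Sum>C\<in>K. t C *\<^sub>R char_vector C)"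
      using constant_cone_combination by blast
    have "(\<Sum>C\<in>A. t C *\<^sub>R char_vector C) \<in> convex_cone hull (char_vector ` K)" if "A \<subseteq> K" for A
      using finite_subset[OF that finite_K] that
    proof (induction A)
      case (insert C A)
      then have "t C *\<^sub>R char_vector C \<in> convex_cone hull (char_vector ` K)"
        using t(1) by (intro convex_cone_hull_mul) (auto intro: hull_inc)
      then show ?case using insert by (simp add: convex_cone_hull_add)
    qed (simp add: convex_cone_hull_contains_0)
    then show "v \<in> convex_cone hull (char_vector ` K)" using t(2) by simp
  qed
qed

lemma inj_on_char_vector: "inj_on char_vector K"
proof
  fix C C' :: "'b set" assume *: "C \<in> K" "C' \<in> K" "char_vector C = (char_vector C' :: 'b \<Rightarrow>\<^sub>0 real)"
  then obtain e where e: "e \<in> C" using class_nonempty by blast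
  then have "e \<in> C'" using * lookup_class[of C e] lookup_class[of C' e] by (metis zero_neq_one)
  then show "C = C'" using class_unique * e by blast
qed

lemma independent_char_vectors: "independent (char_vector ` K)"
proof
  assume "dependent (char_vector ` K)"
  then obtain u where u: "\<exists>v\<in>char_vector ` K. u v \<noteq> 0" "(\<Sum>v\<in>char_vector ` K. u v *\<^sub>R v) = 0"
    using finite_K by (auto simp: real_vector.dependent_finite)
  then obtain C where C: "C \<in> K" "u (char_vector C) \<noteq> 0" by blast
  obtain e where e: "e \<in> C" using class_nonempty C(1) by blast
  have "(\<Sum>C\<in>K. u (char_vector C) *\<^sub>R char_vector C) = 0"
    using u(2) by (simp add: sum.reindex inj_on_char_vector)
  then show False using lookup_combination[OF C(1) e, of "\<lambda>C. u (char_vector C)"] C(2) by simp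
qed

lemma simplicial_constant_cone: "simplicial_cone constant_cone"
  unfolding simplicial_cone_def
  using constant_cone_eq_hull independent_char_vectors finite_K by blast

lemma dim_constant_cone: "dim constant_cone = card K"
proof -
  have "constant_cone \<subseteq> span (char_vector ` K)"
  proof
    fix v assume "v \<in> constant_cone"
    then obtain t where "v = (\<Sum>C\<in>K. t C *\<^sub>R char_vector C)" using constant_cone_combination by blast
    then show "v \<in> span (char_vector ` K)" by (simp add: span_sum span_mul span_base)
  qed
  moreover have "char_vector ` K \<subseteq> constant_cone" using char_vector_class_mem by blast
  ultimately have "card (char_vector ` K) = dim constant_cone"
    using independent_char_vectors by (simp add: real_vector.basis_card_eq_dim)
  then show ?thesis by (simp add: card_image inj_on_char_vector)
qed

text \<open>Extremality of the class vectors: off \<open>C\<close> two nonnegative entries add up to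
  0. It yields both the faces of the cone and the indecomposability of the polytopes belonging to
  the classes.\<close>

lemma summand_of_class:
  assumes v: "v \<in> constant_cone" "w \<in> constant_cone" and C: "C \<in> K"
    and eq: "v + w = m *\<^sub>R char_vector C"
  obtains c where "0 \<le> c" "v = c *\<^sub>R char_vector C"
proof -
  obtain t where t: "\<forall>C\<in>K. 0 \<le> t C" "v = (\<Sum>C\<in>K. t C *\<^sub>R char_vector C)"
      "\<forall>C\<in>K. \<forall>e\<in>C. Poly_Mapping.lookup v e = t C"
    using constant_cone_combination[OF v(1)] by blast
  have "t D *\<^sub>R char_vector D = (if D = C then t C *\<^sub>R char_vector C else 0)" if D: "D \<in> K" for D
  proof (cases "D = C")
    case False
    obtain e where e: "e \<in> D" using class_nonempty[OF D] by blast
    then have "e \<notin> C" using class_unique C D False by blast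
    then have "Poly_Mapping.lookup v e + Poly_Mapping.lookup w e = 0"
      using arg_cong[OF eq, of "\<lambda>x. Poly_Mapping.lookup x e"] by (simp add: lookup_add lookup_class C)
    moreover have "0 \<le> Poly_Mapping.lookup v e" "0 \<le> Poly_Mapping.lookup w e"
      using constant_coneD(2)[OF v(1)] constant_coneD(2)[OF v(2)] subsetD[OF class_subset[OF D] e] by blast+
    ultimately have "t D = 0" using t(3) D e by force
    then show ?thesis using False by simp
  qed simp
  then have "v = (\<Sum>D\<in>K. if D = C then t C *\<^sub>R char_vector C else 0)" unfolding t(2) by (rule sum.cong[OF refl])
  then have "v = t C *\<^sub>R char_vector C" using C finite_K by simp
  then show ?thesis using that t(1) C by blast
qed

lemma char_vector_class_nonzero: "C \<in> K \<Longrightarrow> char_vector C \<noteq> (0 :: 'b \<Rightarrow>\<^sub>0 real)"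
  using lookup_class class_nonempty by (metis ex_in_conv lookup_zero zero_neq_one)

text \<open>The endpoints of a segment through the ray, weighted with \<open>1 - u\<close> and
  \<open>u\<close>, are members of the cone whose sum is a multiple of
  \<open>char_vector C\<close>.\<close>

lemma face_of_ray:
  assumes C: "C \<in> K"
  shows "convex_cone hull {char_vector C} face_of constant_cone"
  unfolding face_of_def
proof (intro conjI ballI impI)
  let ?R = "convex_cone hull {char_vector C}"
  show "?R \<subseteq> constant_cone"
    using char_vector_class_mem[OF C] convex_cone_constant_cone by (intro hull_minimal) auto
  show "convex ?R" by (rule convex_convex_cone_hull)
  fix a b x assume ab: "a \<in> constant_cone" "b \<in> constant_cone" and x: "x \<in> ?R" "x \<in> open_segment a b"
  obtain k where k: "x = k *\<^sub>R char_vector C" using x(1) unfolding convex_cone_hull_singleton by blast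
  obtain u where u: "0 < u" "u < 1" "x = (1 - u) *\<^sub>R a + u *\<^sub>R b" using x(2) by (auto simp: in_segment)
  have scaled: "(1 - u) *\<^sub>R a \<in> constant_cone" "u *\<^sub>R b \<in> constant_cone"
    using ab u convex_cone_constant_cone by (auto intro: convex_cone_scaleR)
  have eq: "(1 - u) *\<^sub>R a + u *\<^sub>R b = k *\<^sub>R char_vector C" "u *\<^sub>R b + (1 - u) *\<^sub>R a = k *\<^sub>R char_vector C"
    using u k by (simp_all add: add.commute)
  obtain s where s: "0 \<le> s" "(1 - u) *\<^sub>R a = s *\<^sub>R char_vector C"
    using summand_of_class[OF scaled C eq(1)] by blast
  obtain r where r: "0 \<le> r" "u *\<^sub>R b = r *\<^sub>R char_vector C"
    using summand_of_class[OF scaled(2,1) C eq(2)] by blast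
  have "a = (s / (1 - u)) *\<^sub>R char_vector C"
    using arg_cong[OF s(2), of "\<lambda>z. (1 / (1 - u)) *\<^sub>R z"] u by simp
  moreover have "b = (r / u) *\<^sub>R char_vector C"
    using arg_cong[OF r(2), of "\<lambda>z. (1 / u) *\<^sub>R z"] u by simp
  moreover have "0 \<le> s / (1 - u)" "0 \<le> r / u" using s r u by auto
  ultimately show "a \<in> ?R" "b \<in> ?R" unfolding convex_cone_hull_singleton by blast+
qed

lemma dim_ray:
  assumes C: "C \<in> K"
  shows "dim (convex_cone hull {char_vector C :: 'b \<Rightarrow>\<^sub>0 real}) = 1"
proof -
  have "convex_cone hull {char_vector C} \<subseteq> span {char_vector C :: 'b \<Rightarrow>\<^sub>0 real}"
    unfolding convex_cone_hull_singleton by (auto intro: span_mul span_base)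
  moreover have "independent {char_vector C :: 'b \<Rightarrow>\<^sub>0 real}"
    using char_vector_class_nonzero[OF C] by simp
  ultimately show ?thesis
    using real_vector.basis_card_eq_dim[of "{char_vector C :: 'b \<Rightarrow>\<^sub>0 real}"] hull_subset[of "{char_vector C :: 'b \<Rightarrow>\<^sub>0 real}" convex_cone]
    by simp
qed

text \<open>A nonzero member \<open>b\<close> of the face is a positive multiple of some class
  vector plus a rest in the cone. The face property puts this class vector into \<open>F\<close>,
  and dimension 1 leaves room for nothing else.\<close>

lemma ray_of_face:
  assumes F: "F face_of constant_cone" "dim F = 1"
  obtains C where "C \<in> K" "F = convex_cone hull {char_vector C}"
proof -
  have sub: "F \<subseteq> constant_cone" using F(1) face_of_imp_subset by blast
  \<comment> \<open>A factor above 1 works because \<open>x\<close> lies strictly between 0 and the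
    multiple. Smaller factors follow by convexity after the same argument, with twice
    \<open>x\<close>, has put 0 into \<open>F\<close>.\<close>
  have scale: "k *\<^sub>R x \<in> F" if x: "x \<in> F" and k: "0 \<le> k" for x k
  proof (cases "k \<le> 1 \<or> x = 0")
    case False
    then have "x \<in> open_segment 0 (k *\<^sub>R x)"
      by (auto simp: in_segment intro!: exI[of _ "1 / k"])
    moreover have "0 \<in> constant_cone" "k *\<^sub>R x \<in> constant_cone"
      using x k sub convex_cone_constant_cone by (auto intro: convex_cone_scaleR convex_cone_contains_0)
    ultimately show ?thesis using face_ofD[OF F(1)] x by blast
  next
    case True
    show ?thesis
    proof (cases "x = 0")
      case False
      then have "x \<in> open_segment 0 (2 *\<^sub>R x)" by (auto simp: in_segment intro!: exI[of _ "1 / 2"])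
      moreover have "0 \<in> constant_cone" "2 *\<^sub>R x \<in> constant_cone"
        using x sub convex_cone_constant_cone by (auto intro: convex_cone_scaleR convex_cone_contains_0)
      ultimately have "0 \<in> F" using face_ofD[OF F(1)] x by blast
      then have "(1 - k) *\<^sub>R 0 + k *\<^sub>R x \<in> F"
        using x True False k face_of_imp_convex[OF F(1)] by (intro convexD) auto
      then show ?thesis by simp
    qed (use x in simp)
  qed
  obtain B where B: "B \<subseteq> F" "independent B" "F \<subseteq> span B" "card B = 1"
    using real_vector.basis_exists[of F] F(2) by metis
  then obtain b where b: "B = {b}" using card_1_singletonE by blast
  have bF: "b \<in> F" "b \<noteq> 0" using B b by auto
  obtain t where t: "\<forall>C\<in>K. 0 \<le> t C" "b = (\<Sum>C\<in>K. t C *\<^sub>R char_vector C)"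
    using constant_cone_combination[of b] bF(1) sub by blast
  have "\<exists>C\<in>K. t C \<noteq> 0"
  proof (rule ccontr)
    assume "\<not> (\<exists>C\<in>K. t C \<noteq> 0)"
    then have "b = 0" unfolding t(2) by (intro sum.neutral) auto
    then show False using bF(2) by simp
  qed
  then obtain C where C: "C \<in> K" "t C \<noteq> 0" by blast
  define rest where "rest = (\<Sum>D\<in>K - {C}. t D *\<^sub>R char_vector D)"
  have b_eq: "b = t C *\<^sub>R char_vector C + rest"
    unfolding t(2) rest_def using C(1) finite_K by (simp add: sum.remove)
  have "rest = (\<Sum>D\<in>K. (if D = C then 0 else t D) *\<^sub>R char_vector D)"
    unfolding rest_def using finite_K C(1) by (simp add: sum.remove[of K C])
  moreover have "(\<Sum>D\<in>A. s D *\<^sub>R char_vector D) \<in> constant_cone"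
    if "A \<subseteq> K" "\<And>D. D \<in> K \<Longrightarrow> 0 \<le> s D" for A s
    using finite_subset[OF that(1) finite_K] that(1)
  proof (induction A)
    case empty then show ?case using convex_cone_constant_cone by (simp add: convex_cone_contains_0)
  next
    case (insert D A)
    then have "s D *\<^sub>R char_vector D \<in> constant_cone"
      using that char_vector_class_mem convex_cone_constant_cone by (auto intro: convex_cone_scaleR)
    then show ?case using insert convex_cone_constant_cone by (simp add: convex_cone_add)
  qed
  ultimately have rest: "rest \<in> constant_cone" using t(1) by simp
  have p: "t C *\<^sub>R char_vector C \<in> constant_cone"
    using t(1) C(1) char_vector_class_mem[OF C(1)] convex_cone_constant_cone by (auto intro: convex_cone_scaleR)
  \<comment> \<open>\<open>b\<close> is the midpoint of twice the class part and twice the rest. If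
    these coincide, the open segment is empty, but then \<open>b\<close> itself is twice the class
    part.\<close>
  have chi: "2 *\<^sub>R t C *\<^sub>R char_vector C \<in> F"
  proof (cases "t C *\<^sub>R char_vector C = rest")
    case True
    then have "2 *\<^sub>R t C *\<^sub>R char_vector C = b" unfolding b_eq by (simp add: scaleR_2)
    then show ?thesis using bF by simp
  next
    case False
    then have "2 *\<^sub>R t C *\<^sub>R char_vector C \<noteq> 2 *\<^sub>R rest"
      by (metis scaleR_cancel_left zero_neq_numeral)
    then have "b \<in> open_segment (2 *\<^sub>R t C *\<^sub>R char_vector C) (2 *\<^sub>R rest)"
      unfolding b_eq in_segment by (auto intro!: exI[of _ "1 / 2"])
    moreover have "2 *\<^sub>R t C *\<^sub>R char_vector C \<in> constant_cone" "2 *\<^sub>R rest \<in> constant_cone"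
      by (rule convex_cone_scaleR[OF convex_cone_constant_cone _ p] convex_cone_scaleR[OF convex_cone_constant_cone _ rest], simp)+
    ultimately show ?thesis using face_ofD[OF F(1)] bF by blast
  qed
  have tpos: "0 < t C" using C t(1) by (simp add: order.strict_iff_order)
  have "(1 / (2 * t C)) *\<^sub>R (2 *\<^sub>R t C *\<^sub>R char_vector C) \<in> F"
    by (rule scale[OF chi]) (use tpos in simp)
  then have chiF: "char_vector C \<in> F" using tpos by simp
  have "F = convex_cone hull {char_vector C}"
  proof
    show "convex_cone hull {char_vector C} \<subseteq> F"
      unfolding convex_cone_hull_singleton using scale[OF chiF] by blast
    show "F \<subseteq> convex_cone hull {char_vector C}"
    proof
      fix x assume x: "x \<in> F"
      obtain j where j: "x = j *\<^sub>R b" using x B b by (auto simp: span_singleton)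
      obtain k where k: "char_vector C = k *\<^sub>R b" using chiF B b by (auto simp: span_singleton)
      have "k \<noteq> 0" using k char_vector_class_nonzero[OF C(1)] by auto
      then have xj: "x = (j / k) *\<^sub>R char_vector C" unfolding k j by simp
      \<comment> \<open>The span also allows negative factors; the entry of \<open>x\<close> at an
        element of \<open>C\<close> shows that \<open>j / k\<close> is nonnegative.\<close>
      obtain e where e: "e \<in> C" using class_nonempty[OF C(1)] by blast
      have "0 \<le> Poly_Mapping.lookup x e"
        using constant_coneD(2)[OF subsetD[OF sub x] subsetD[OF class_subset[OF C(1)] e]] .
      then have "0 \<le> j / k" unfolding xj using e lookup_class[OF C(1)] by simp
      then show "x \<in> convex_cone hull {char_vector C}" unfolding convex_cone_hull_singleton using xj by blast
    qed
  qed
  then show ?thesis using that C(1) by blast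
qed

lemma rays_constant_cone: "rays constant_cone = (\<lambda>C. convex_cone hull {char_vector C}) ` K"
  unfolding rays_def using face_of_ray dim_ray ray_of_face by (auto elim!: ray_of_face)

end

section \<open>Polytopes with triangular and parallelogram 2-faces\<close>

lemma equiv_edge_equiv: "equiv (edges P) (edge_equiv P)"
  unfolding edge_equiv_def
  by (intro equivI) (auto intro!: refl_onI symI transI intro: equivclp_sym equivclp_trans)

lemma edge_step_edges:
  assumes "edge_step P e f"
  shows "e \<in> edges P" "f \<in> edges P"
  using assms edge_of_face unfolding edge_step_def edges_def by blast+

lemma edge_equiv_constant:
  assumes "\<And>e f. edge_step P e f \<Longrightarrow> l e = l f" "(e, f) \<in> edge_equiv P"
  shows "l e = l f"
proof -
  have "equivclp (edge_step P) e f" using assms(2) by (simp add: edge_equiv_def)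
  then show ?thesis
  proof (induction rule: equivclp_induct)
    case (step y z)
    then show ?case using assms(1)[of y z] assms(1)[of z y] by auto
  qed simp
qed

section \<open>Normal fans under homotheties\<close>

lemma normal_cone_homothety:
  fixes P :: "'a::euclidean_space set"
  assumes "0 < l"
  shows "normal_cone ((\<lambda>x. l *\<^sub>R x + t) ` P) ((\<lambda>x. l *\<^sub>R x + t) ` F) = normal_cone P F"
  using assms by (auto simp: normal_cone_def inner_add_right)

lemma face_of_homothety:
  fixes P :: "'a::euclidean_space set"
  assumes "F face_of P" "l \<noteq> 0"
  shows "(\<lambda>x. l *\<^sub>R x + t) ` F face_of (\<lambda>x. l *\<^sub>R x + t) ` P"
proof -
  have eq: "(\<lambda>x. l *\<^sub>R x + t) ` X = (+) t ` (\<lambda>x. l *\<^sub>R x) ` X" for X :: "'a set"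
    by (simp add: image_image add.commute)
  have "(\<lambda>x. l *\<^sub>R x) ` F face_of (\<lambda>x. l *\<^sub>R x) ` P"
    using assms face_of_linear_image[of "\<lambda>x. l *\<^sub>R x" F P] by (simp add: inj_on_def)
  then show ?thesis unfolding eq face_of_translation_eq .
qed

lemma normal_fan_homothety:
  fixes P :: "'a::euclidean_space set"
  assumes l: "0 < l"
  shows "normal_fan ((\<lambda>x. l *\<^sub>R x + t) ` P) = normal_fan P"
proof -
  have sub: "normal_fan P \<subseteq> normal_fan ((\<lambda>x. l *\<^sub>R x + t) ` P)" if "0 < l" for P :: "'a set" and l t
  proof
    fix N assume "N \<in> normal_fan P"
    then obtain F where F: "N = normal_cone P F" "F face_of P" "F \<noteq> {}" unfolding normal_fan_def by blast
    have "N = normal_cone ((\<lambda>x. l *\<^sub>R x + t) ` P) ((\<lambda>x. l *\<^sub>R x + t) ` F)"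
      unfolding F(1) by (rule normal_cone_homothety[OF that, symmetric])
    moreover have "(\<lambda>x. l *\<^sub>R x + t) ` F face_of (\<lambda>x. l *\<^sub>R x + t) ` P"
      by (rule face_of_homothety[OF F(2)]) (use that in simp)
    moreover have "(\<lambda>x. l *\<^sub>R x + t) ` F \<noteq> {}" using F(3) by blast
    ultimately show "N \<in> normal_fan ((\<lambda>x. l *\<^sub>R x + t) ` P)" unfolding normal_fan_def by blast
  qed
  \<comment> \<open>The reverse inclusion is the same inclusion for the inverse homothety.\<close>
  have "(\<lambda>x. (1 / l) *\<^sub>R x + (- (1 / l)) *\<^sub>R t) ` (\<lambda>x. l *\<^sub>R x + t) ` P = P"
    using l by (simp add: image_image scaleR_add_right)
  then have "normal_fan ((\<lambda>x. l *\<^sub>R x + t) ` P) \<subseteq> normal_fan P"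
    using sub[of "1 / l" "(\<lambda>x. l *\<^sub>R x + t) ` P" "(- (1 / l)) *\<^sub>R t"] l by simp
  then show ?thesis using sub[OF l] by blast
qed

locale triangle_parallelogram_polytope =
  fixes P :: "'a::euclidean_space set"
  assumes polytope: "polytope P" and nonempty: "P \<noteq> {}"
    and two_faces: "\<And>F. F face_of P \<Longrightarrow> aff_dim F = 2 \<Longrightarrow> 2 simplex F \<or> parallelogram F"
begin

sublocale edge_partition "edges P" "edge_classes P"
proof
  show "finite (edges P)" using finite_edges polytope .
  show "partition_on (edges P) (edge_classes P)"
    unfolding edge_classes_def by (rule partition_on_quotient[OF equiv_edge_equiv])
qed

lemma deformation_cone_eq: "deformation_cone P = constant_cone"
proof
  show "deformation_cone P \<subseteq> constant_cone"
  proof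
    fix v assume "v \<in> deformation_cone P"
    then obtain Q where "edge_deformation_vector P Q v" unfolding deformation_cone_def by blast
    then obtain q where v: "Poly_Mapping.keys v \<subseteq> edges P" "\<forall>e\<in>edges P. 0 \<le> Poly_Mapping.lookup v e"
      and q: "edge_potential P q (Poly_Mapping.lookup v)"
      unfolding edge_deformation_vector_alt by blast
    have step: "Poly_Mapping.lookup v e = Poly_Mapping.lookup v f" if "edge_step P e f" for e f
      using edge_step_scalars_eq[OF that] q unfolding edge_potential_def by blast
    show "v \<in> constant_cone"
    proof (rule constant_coneI[OF v(1)])
      fix C e f assume C: "C \<in> edge_classes P" "e \<in> C" "f \<in> C"
      then obtain g where "C = edge_equiv P `` {g}" unfolding edge_classes_def by (metis quotientE)
      then have g: "(g, e) \<in> edge_equiv P" "(g, f) \<in> edge_equiv P" using C by auto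
      have "Poly_Mapping.lookup v g = Poly_Mapping.lookup v e" "Poly_Mapping.lookup v g = Poly_Mapping.lookup v f"
        by (rule edge_equiv_constant[OF step], assumption, rule g)+
      then show "Poly_Mapping.lookup v e = Poly_Mapping.lookup v f" by simp
    qed (use v in blast)
  qed
  show "constant_cone \<subseteq> deformation_cone P"
  proof
    fix v assume v: "v \<in> constant_cone"
    have "Poly_Mapping.lookup v e = Poly_Mapping.lookup v f" if step: "edge_step P e f" for e f
    proof (rule constant_coneD(3)[OF v])
      have "e \<in> edges P" "(e, f) \<in> edge_equiv P"
        using edge_step_edges[OF step] step by (auto simp: edge_equiv_def)
      then show "edge_equiv P `` {e} \<in> edge_classes P" "f \<in> edge_equiv P `` {e}"
        unfolding edge_classes_def by (auto intro: quotientI)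
      show "e \<in> edge_equiv P `` {e}" using equiv_class_self[OF equiv_edge_equiv \<open>e \<in> edges P\<close>] .
    qed
    then obtain q where q: "edge_potential P q (Poly_Mapping.lookup v)"
      by (rule edge_potential_exists[OF polytope two_faces, rotated 2]) auto
    obtain Q where "deformation P Q" "edge_deformation_vector P Q v"
      by (rule deformation_of_edge_potential[OF polytope nonempty q constant_coneD(2)[OF v] constant_coneD(1)[OF v]])
    then show "v \<in> deformation_cone P" unfolding deformation_cone_def by blast
  qed
qed

section \<open>The polytopes belonging to the classes\<close>

lemma class_deformation_exists: "C \<in> edge_classes P \<Longrightarrow> \<exists>Q. class_deformation P C Q"
  using char_vector_class_mem[of C] deformation_cone_eq
  unfolding deformation_cone_def class_deformation_def by blast

lemma edge_decomposable: "edge_decomposable P"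
  unfolding edge_decomposable_def
proof (intro exI conjI ballI)
  show "partition_on (edges P) (edge_classes P)" by (rule partition)
  fix C assume C: "C \<in> edge_classes P"
  have fin: "finite (edges P - C)" using finite_E by blast
  have lk: "Poly_Mapping.lookup (char_vector (edges P - C)) e = (if e \<in> edges P - C then 1 else 0)" for e
    by (rule lookup_char_vector[OF fin])
  \<comment> \<open>The complement of a class is a union of classes, so its characteristic vector is
    constant on every class.\<close>
  have "char_vector (edges P - C) \<in> constant_cone"
  proof (rule constant_coneI)
    show "Poly_Mapping.keys (char_vector (edges P - C)) \<subseteq> edges P"
      by (auto simp: in_keys_iff lk split: if_splits)
  next
    fix D e f assume D: "D \<in> edge_classes P" "e \<in> D" "f \<in> D"
    have "e \<in> edges P - C \<longleftrightarrow> f \<in> edges P - C"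
      using class_unique[OF C D(1)] D class_subset[OF D(1)] by blast
    then show "Poly_Mapping.lookup (char_vector (edges P - C)) e = Poly_Mapping.lookup (char_vector (edges P - C)) f"
      unfolding lk by simp
  qed (simp add: lk)
  then show "contractible_edges P C"
    unfolding contractible_edges_def deformation_cone_eq using class_subset[OF C] by blast
  show "dependent_edges P C"
    unfolding dependent_edges_def deformation_cone_eq
    using class_subset[OF C] constant_coneD(3)[OF _ C] by blast
qed

lemma vector_exists:
  assumes "deformation P Q"
  obtains v where "edge_deformation_vector P Q v" "v \<in> constant_cone"
proof -
  obtain v where v: "edge_deformation_vector P Q v"
    using edge_deformation_vector_exists[OF polytope assms] by blast
  then have "v \<in> deformation_cone P" using assms unfolding deformation_cone_def by blast
  then show ?thesis using that v deformation_cone_eq by blast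
qed

lemma class_deformation_homothetic:
  assumes Q: "class_deformation P C Q" and c: "0 \<le> c"
    and S: "deformation P S" "edge_deformation_vector P S (c *\<^sub>R char_vector C)"
  obtains t where "S = (\<lambda>x. c *\<^sub>R x + t) ` Q"
proof -
  have def: "deformation P Q" and v: "edge_deformation_vector P Q (char_vector C)"
    using Q unfolding class_deformation_def by auto
  obtain t where "S = (+) t ` (\<lambda>x. c *\<^sub>R x) ` Q"
    using deformation_unique[OF polytope nonempty deformation_scale(1)[OF polytope nonempty def c] S(1)
        deformation_scale(2)[OF polytope nonempty def c v] S(2)] by blast
  then show ?thesis using that[of t] by (simp add: image_image add.commute)
qed

lemma class_deformation_not_point:
  assumes "C \<in> edge_classes P" "class_deformation P C Q"
  shows "\<not> (\<exists>x. Q = {x})"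
proof
  assume "\<exists>x. Q = {x}"
  then obtain x where "Q = {x}" by blast
  then have "char_vector C = (0 :: 'a set \<Rightarrow>\<^sub>0 real)"
    using assms(2) deformation_singleton(2)[OF polytope nonempty] edge_deformation_vector_unique[OF polytope]
    unfolding class_deformation_def by blast
  then show False using char_vector_class_nonzero[OF assms(1)] by blast
qed

text \<open>If \<open>S\<close> is a deformation of \<open>Q\<close> with complement
  \<open>T\<close>, both are deformations of \<open>P\<close>, and their vectors add up to a
  multiple of \<open>char_vector C\<close>. By extremality the vector of \<open>S\<close> is such a
  multiple too, and the vector determines \<open>S\<close> up to translation.\<close>

lemma class_deformation_indecomposable:
  assumes C: "C \<in> edge_classes P" and Q: "class_deformation P C Q"
  shows "indecomposable Q"
  unfolding indecomposable_def
proof (intro conjI allI impI)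
  have def: "deformation P Q" and v: "edge_deformation_vector P Q (char_vector C)"
    using Q unfolding class_deformation_def by auto
  show "polytope Q" "Q \<noteq> {}" using def unfolding deformation_def by auto
  fix S assume S: "deformation Q S"
  then obtain m T where mT: "0 < m" "polytope T" "T \<noteq> {}" "(\<lambda>x. m *\<^sub>R x) ` Q = S + T" "polytope S" "S \<noteq> {}"
    unfolding deformation_def by blast
  have T: "deformation Q T" unfolding deformation_def using mT by (metis add.commute)
  have PS: "deformation P S" and PT: "deformation P T" using deformation_trans[OF def] S T by blast+
  obtain vS where vS: "edge_deformation_vector P S vS" "vS \<in> constant_cone" using vector_exists[OF PS] by blast
  obtain vT where vT: "edge_deformation_vector P T vT" "vT \<in> constant_cone" using vector_exists[OF PT] by blast
  have "edge_deformation_vector P (S + T) (m *\<^sub>R char_vector C)"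
    using deformation_scale(2)[OF polytope nonempty def, of m] v mT(1) unfolding mT(4) by simp
  then have "vS + vT = m *\<^sub>R char_vector C"
    using edge_deformation_vector_unique[OF polytope deformation_add(1)[OF polytope PS PT]
        deformation_add(2)[OF polytope PS PT vS(1) vT(1)]] by blast
  then obtain c where c: "0 \<le> c" "vS = c *\<^sub>R char_vector C"
    using summand_of_class[OF vS(2) vT(2) C] by blast
  obtain t where "S = (\<lambda>x. c *\<^sub>R x + t) ` Q"
    using class_deformation_homothetic[OF Q c(1) PS] vS(1) c(2) by blast
  then show "\<exists>l\<ge>0. \<exists>t. S = (\<lambda>x. l *\<^sub>R x + t) ` Q" using c(1) by blast
qed

text \<open>
  Contracting an edge merges the normal cones of its two ends: a cone of the fan of \<open>Q'\<close> contains both,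
  whereas no cone of the fan of \<open>Q\<close> does.
\<close>

lemma class_deformation_normal_fan:
  assumes C: "C \<in> edge_classes P" "C' \<in> edge_classes P"
    and Q: "class_deformation P C Q" "class_deformation P C' Q'"
    and fan: "normal_fan Q = normal_fan Q'"
  shows "C = C'"
proof (rule ccontr)
  assume "C \<noteq> C'"
  obtain e where e: "e \<in> C" using class_nonempty[OF C(1)] by blast
  then have "e \<notin> C'" using class_unique C \<open>C \<noteq> C'\<close> by blast
  have "e \<in> edges P" using e class_subset[OF C(1)] by blast
  then have "e edge_of P" by (simp add: edges_def)
  then obtain p p' where pp: "p \<noteq> p'" "p extreme_point_of P" "p' extreme_point_of P" "e = closed_segment p p'"
    by (rule polytope_edge_obtain[OF polytope])
  then have ad: "adjacent P p p'" using \<open>e edge_of P\<close> by simp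
  have def: "deformation P Q" and v: "edge_deformation_vector P Q (char_vector C)"
    and def': "deformation P Q'" and v': "edge_deformation_vector P Q' (char_vector C')"
    using Q unfolding class_deformation_def by auto
  obtain q where q: "associated_vertices P Q q" "edge_potential P q (Poly_Mapping.lookup (char_vector C))"
    using v unfolding edge_deformation_vector_alt by blast
  obtain q' where q': "associated_vertices P Q' q'" "edge_potential P q' (Poly_Mapping.lookup (char_vector C'))"
    using v' unfolding edge_deformation_vector_alt by blast
  \<comment> \<open>The edge \<open>e\<close> lies in \<open>C\<close> but not in \<open>C'\<close>:
    its ends stay apart in \<open>Q\<close> and coincide in \<open>Q'\<close>.\<close>
  have "q p - q p' = p - p'"
    using q(2) ad e pp(4) lookup_class[OF C(1), of e] unfolding edge_potential_def by auto
  then have qne: "q p \<noteq> q p'" using pp(1) by auto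
  have "q' p - q' p' = 0"
    using q'(2) ad \<open>e \<notin> C'\<close> pp(4) lookup_class[OF C(2), of e] unfolding edge_potential_def by auto
  then have q'eq: "q' p = q' p'" by simp
  obtain c where c: "\<And>x. x \<in> P \<Longrightarrow> x \<noteq> p \<Longrightarrow> c \<bullet> x < c \<bullet> p"
    using polytope_extreme_exposed polytope pp(2) by blast
  obtain c' where c': "\<And>x. x \<in> P \<Longrightarrow> x \<noteq> p' \<Longrightarrow> c' \<bullet> x < c' \<bullet> p'"
    using polytope_extreme_exposed polytope pp(3) by blast
  have "c \<in> normal_cone P {p}" "c' \<in> normal_cone P {p'}"
    using c c' by (force simp: normal_cone_singleton)+
  then have "c \<in> normal_cone Q' {q' p}" "c' \<in> normal_cone Q' {q' p'}"
    using q'(1) pp(2,3) unfolding associated_vertices_def by blast+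
  note this[folded q'eq]
  moreover have "normal_cone Q' {q' p} \<in> normal_fan Q'"
  proof -
    have "{q' p} face_of Q'" using q'(1) pp(2) unfolding associated_vertices_def face_of_singleton by blast
    then show ?thesis unfolding normal_fan_def by blast
  qed
  ultimately obtain F where F: "F face_of Q" "F \<noteq> {}" "c \<in> normal_cone Q F" "c' \<in> normal_cone Q F"
    unfolding fan[symmetric] unfolding normal_fan_def by blast
  then obtain x where x: "x \<in> F" "x \<in> Q" using face_of_imp_subset by blast
  have qQ: "q p \<in> Q" "q p' \<in> Q" using q(1) pp(2,3) unfolding associated_vertices_def extreme_point_of_def by blast+
  have "c \<bullet> q p \<le> c \<bullet> x" "c' \<bullet> q p' \<le> c' \<bullet> x" using F(3,4) x qQ unfolding normal_cone_def by blast+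
  \<comment> \<open>On \<open>Q\<close> the functional \<open>c\<close> is maximized only at
    \<open>q p\<close> and \<open>c'\<close> only at \<open>q p'\<close>, yet both are maximized at
    \<open>x\<close>.\<close>
  then have "x = q p" "x = q p'"
    using associated_vertex_exposed[OF polytope def q(1) pp(2) c x(2)]
      associated_vertex_exposed[OF polytope def q(1) pp(3) c' x(2)] by blast+
  then show False using qne by blast
qed

section \<open>The decomposition and its uniqueness\<close>

lemma char_vector_edges: "char_vector (edges P) = (\<Sum>C\<in>edge_classes P. char_vector C)"
proof (rule poly_mapping_eqI)
  fix e
  have eq: "(\<Sum>C\<in>edge_classes P. char_vector C) = (\<Sum>C\<in>edge_classes P. (1::real) *\<^sub>R char_vector C)"
    by simp
  show "Poly_Mapping.lookup (char_vector (edges P)) e = Poly_Mapping.lookup (\<Sum>C\<in>edge_classes P. char_vector C) e"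
  proof (cases "e \<in> edges P")
    case True
    then obtain C where "C \<in> edge_classes P" "e \<in> C" using class_exists by blast
    then show ?thesis unfolding eq using True lookup_combination[of C e "\<lambda>_. 1"] lookup_char_vector[OF finite_E] by simp
  next
    case False
    then show ?thesis unfolding eq using lookup_combination_outside[OF False, of "\<lambda>_. 1"] lookup_char_vector[OF finite_E] by simp
  qed
qed

lemma class_decomposition:
  assumes PC: "\<And>C. C \<in> edge_classes P \<Longrightarrow> class_deformation P C (PC C)"
  shows "indecomposable_decomposition P (edge_classes P) PC"
  unfolding indecomposable_decomposition_def
proof (intro conjI ballI)
  show "finite (edge_classes P)" by (rule finite_K)
  show "inj_on (\<lambda>C. normal_fan (PC C)) (edge_classes P)"
    using class_deformation_normal_fan PC by (intro inj_onI) blast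
  have "deformation P (\<Sum>C\<in>edge_classes P. PC C)"
    "edge_deformation_vector P (\<Sum>C\<in>edge_classes P. PC C) (\<Sum>C\<in>edge_classes P. char_vector C)"
    using PC unfolding class_deformation_def
    by (intro deformation_sum[OF polytope nonempty finite_K, of PC char_vector]; blast)+
  then show "\<exists>t. P = (+) t ` (\<Sum>C\<in>edge_classes P. PC C)"
    using deformation_unique[OF polytope nonempty _ deformation_self[OF polytope nonempty] _
        edge_deformation_vector_self[OF polytope]] unfolding char_vector_edges by metis
qed (use class_deformation_indecomposable class_deformation_not_point PC in blast)+

text \<open>Split the vector of \<open>R\<close> into one class with positive coefficient and the
  rest. This gives, up to translation, a decomposition of \<open>R\<close> with summand
  \<open>S\<close> from that class; since \<open>R\<close> is indecomposable, \<open>S\<close> is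
  homothetic to \<open>R\<close>, and their vectors are proportional.\<close>

lemma indecomposable_vector:
  assumes R: "deformation P R" "indecomposable R" "\<not> (\<exists>x. R = {x})"
    and PC: "\<And>C. C \<in> edge_classes P \<Longrightarrow> class_deformation P C (PC C)"
  obtains C c where "C \<in> edge_classes P" "0 < c" "edge_deformation_vector P R (c *\<^sub>R char_vector C)"
proof -
  obtain v where v: "edge_deformation_vector P R v" "v \<in> constant_cone" using vector_exists[OF R(1)] by blast
  obtain t where t: "\<forall>C\<in>edge_classes P. 0 \<le> t C" "v = (\<Sum>C\<in>edge_classes P. t C *\<^sub>R char_vector C)"
    using constant_cone_combination[OF v(2)] by blast
  have "v \<noteq> 0"
  proof
    assume "v = 0"
    then obtain s where "R = (+) s ` {0}"
      using deformation_unique[OF polytope nonempty deformation_singleton(1)[OF polytope nonempty] R(1)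
          deformation_singleton(2)[OF polytope nonempty]] v(1) by metis
    then show False using R(3) by auto
  qed
  then obtain C where C: "C \<in> edge_classes P" "t C \<noteq> 0"
    unfolding t(2) by (metis (no_types, lifting) scaleR_zero_left sum.neutral)
  have tC: "0 < t C" using t(1) C by (simp add: order.strict_iff_order)
  have PCC: "deformation P (PC C)" "edge_deformation_vector P (PC C) (char_vector C)"
    using PC[OF C(1)] unfolding class_deformation_def by auto
  define S where "S = (\<lambda>x. t C *\<^sub>R x) ` PC C"
  have S: "deformation P S" "edge_deformation_vector P S (t C *\<^sub>R char_vector C)"
    unfolding S_def using deformation_scale[OF polytope nonempty PCC(1), of "t C"] PCC(2) tC by auto
  define T where "T = (\<Sum>D\<in>edge_classes P - {C}. (\<lambda>x. t D *\<^sub>R x) ` PC D)"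
  have D: "deformation P ((\<lambda>x. t D *\<^sub>R x) ` PC D) \<and>
      edge_deformation_vector P ((\<lambda>x. t D *\<^sub>R x) ` PC D) (t D *\<^sub>R char_vector D)"
    if "D \<in> edge_classes P - {C}" for D
    using that t(1) PC[of D] deformation_scale[OF polytope nonempty, of "PC D" "t D"]
    unfolding class_deformation_def by blast
  have finD: "finite (edge_classes P - {C})" using finite_K by blast
  have T: "deformation P T"
    "edge_deformation_vector P T (\<Sum>D\<in>edge_classes P - {C}. t D *\<^sub>R char_vector D)"
    unfolding T_def by (rule deformation_sum[OF polytope nonempty finD]; use D in blast)+
  have "v = t C *\<^sub>R char_vector C + (\<Sum>D\<in>edge_classes P - {C}. t D *\<^sub>R char_vector D)"
    unfolding t(2) using C(1) finite_K by (simp add: sum.remove)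
  then have "edge_deformation_vector P (S + T) v" using deformation_add(2)[OF polytope S(1) T(1) S(2) T(2)] by simp
  then obtain s where s: "S + T = (+) s ` R"
    using deformation_unique[OF polytope nonempty R(1) deformation_add(1)[OF polytope S(1) T(1)] v(1)] by blast
  \<comment> \<open>The translation is moved into the complementary summand, as the definition of a
    deformation asks for an exact sum.\<close>
  have "(\<lambda>x. 1 *\<^sub>R x) ` R = S + (+) (- s) ` T"
  proof -
    have "(+) (- s) ` T = {- s} + T" by (auto simp: set_plus_def)
    then have "S + (+) (- s) ` T = {- s} + (S + T)" by (simp add: add.left_commute)
    also have "\<dots> = R" unfolding s by (auto simp: set_plus_def)
    finally show ?thesis by simp
  qed
  moreover have "polytope S" "S \<noteq> {}" "polytope T" "T \<noteq> {}" using S T unfolding deformation_def by auto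
  moreover have "polytope ((+) (- s) ` T)" using \<open>polytope T\<close> polytope_translation_eq by blast
  ultimately have "deformation R S"
    unfolding deformation_def by (metis image_is_empty zero_less_one)
  then obtain l u where l: "0 \<le> l" "S = (\<lambda>x. l *\<^sub>R x + u) ` R" using R(2) unfolding indecomposable_def by blast
  have "S = (+) u ` (\<lambda>x. l *\<^sub>R x) ` R" unfolding l(2) by (simp add: image_image add.commute)
  then have "edge_deformation_vector P S (l *\<^sub>R v)"
    using deformation_translation(2)[OF polytope nonempty deformation_scale(1)[OF polytope nonempty R(1) l(1)]
        deformation_scale(2)[OF polytope nonempty R(1) l(1) v(1)]] by simp
  then have eq: "t C *\<^sub>R char_vector C = l *\<^sub>R v"
    using edge_deformation_vector_unique[OF polytope S(1) S(2)] by blast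
  \<comment> \<open>Homothety in the definition of indecomposability admits factor 0, that is, a
    point; the nonzero vector of \<open>S\<close> excludes it.\<close>
  have "l \<noteq> 0" using eq tC char_vector_class_nonzero[OF C(1)] by auto
  then have "v = (t C / l) *\<^sub>R char_vector C"
    using arg_cong[OF eq, of "\<lambda>z. (1 / l) *\<^sub>R z"] by simp
  moreover have "0 < t C / l" using tC l(1) \<open>l \<noteq> 0\<close> by simp
  ultimately show ?thesis using that C(1) v(1) by blast
qed

text \<open>Each \<open>R i\<close> is a positive dilate of the polytope of a class
  \<open>f i\<close>. Homothetic polytopes have equal normal fans, so \<open>f\<close> is injective,
  and the coefficients in the all-ones vector show that every class occurs, with factor 1.\<close>

lemma decomposition_unique:
  fixes R :: "nat \<Rightarrow> 'a set"
  assumes PC: "\<And>C. C \<in> edge_classes P \<Longrightarrow> class_deformation P C (PC C)"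
    and R: "indecomposable_decomposition P {..<n} R"
  shows "\<exists>f. bij_betw f {..<n} (edge_classes P) \<and> (\<forall>i<n. \<exists>t. R i = (+) t ` PC (f i))"
proof -
  have ind: "indecomposable (R i)" "\<not> (\<exists>x. R i = {x})" if "i < n" for i
    using R that unfolding indecomposable_decomposition_def by auto
  have fan: "inj_on (\<lambda>i. normal_fan (R i)) {..<n}" using R unfolding indecomposable_decomposition_def by blast
  obtain t where t: "P = (+) t ` (\<Sum>i<n. R i)" using R unfolding indecomposable_decomposition_def by blast
  have polyR: "polytope (R i)" "R i \<noteq> {}" if "i < n" for i
    using ind(1)[OF that] unfolding indecomposable_def by auto
  have sums: "polytope (\<Sum>i\<in>I. R i) \<and> (\<Sum>i\<in>I. R i) \<noteq> {}" if "I \<subseteq> {..<n}" for I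
    using finite_subset[OF that finite_lessThan] that
  proof (induction I)
    case (insert i I)
    then show ?case using polyR by (simp add: polytope_set_plus set_plus_nonempty)
  qed (simp add: polytope_sing)
  have defR: "deformation P (R i)" if i: "i < n" for i
  proof -
    \<comment> \<open>The other summands together with the translation form the complement of
      \<open>R i\<close> in \<open>P\<close>.\<close>
    let ?T = "\<Sum>j\<in>{..<n} - {i}. R j"
    have "(\<Sum>j<n. R j) = R i + ?T" using i by (simp add: sum.remove)
    then have "P = {t} + (R i + ?T)" using t by (auto simp: set_plus_def)
    also have "\<dots> = R i + ({t} + ?T)" by (simp add: add.left_commute)
    finally have "(\<lambda>x. 1 *\<^sub>R x) ` P = R i + ({t} + ?T)" by simp
    moreover have "polytope ({t} + ?T)" "{t} + ?T \<noteq> {}"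
      using sums[of "{..<n} - {i}"] by (auto intro!: polytope_set_plus set_plus_nonempty polytope_sing)
    ultimately show ?thesis unfolding deformation_def using polyR[OF i] zero_less_one by blast
  qed
  have "\<exists>C c. C \<in> edge_classes P \<and> 0 < c \<and> edge_deformation_vector P (R i) (c *\<^sub>R char_vector C)"
    if "i < n" for i
    using indecomposable_vector[OF defR[OF that] ind(1)[OF that] ind(2)[OF that] PC] by metis
  then obtain f c where fc: "\<And>i. i < n \<Longrightarrow> f i \<in> edge_classes P" "\<And>i. i < n \<Longrightarrow> (0::real) < c i"
      "\<And>i. i < n \<Longrightarrow> edge_deformation_vector P (R i) (c i *\<^sub>R char_vector (f i))"
    by metis
  have homothetic: "\<exists>s. R i = (\<lambda>x. c i *\<^sub>R x + s) ` PC (f i)" if "i < n" for i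
    using class_deformation_homothetic[OF PC[OF fc(1)[OF that]] less_imp_le[OF fc(2)[OF that]] defR[OF that] fc(3)[OF that]]
    by metis
  have inj: "inj_on f {..<n}"
  proof (rule inj_onI)
    fix i j assume ij: "i \<in> {..<n}" "j \<in> {..<n}" "f i = f j"
    have "normal_fan (R k) = normal_fan (PC (f k))" if k: "k \<in> {..<n}" for k
    proof -
      have "k < n" using k by simp
      then obtain s where "R k = (\<lambda>x. c k *\<^sub>R x + s) ` PC (f k)" using homothetic by blast
      then show ?thesis using normal_fan_homothety fc(2)[OF \<open>k < n\<close>] by simp
    qed
    then have "normal_fan (R i) = normal_fan (R j)" using ij by simp
    then show "i = j" using fan ij(1,2) by (simp add: inj_on_def)
  qed
  have "deformation P (\<Sum>i<n. R i)" "edge_deformation_vector P (\<Sum>i<n. R i) (\<Sum>i<n. c i *\<^sub>R char_vector (f i))"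
    by (rule deformation_sum[OF polytope nonempty finite_lessThan, where Q = R and v = "\<lambda>i. c i *\<^sub>R char_vector (f i)"];
        use defR fc(3) in simp)+
  then have "edge_deformation_vector P P (\<Sum>i<n. c i *\<^sub>R char_vector (f i))"
    using deformation_translation(2)[OF polytope nonempty] t by metis
  then have eq: "(\<Sum>i<n. c i *\<^sub>R char_vector (f i)) = char_vector (edges P)"
    using edge_deformation_vector_unique[OF polytope deformation_self[OF polytope nonempty]]
      edge_deformation_vector_self[OF polytope] by blast
  \<comment> \<open>The factors transported to classes, with 0 for classes that do not occur; once
    all values are known to be 1, no such class is left.\<close>
  define g where "g C = (if C \<in> f ` {..<n} then c (inv_into {..<n} f C) else 0)" for C
  have gf: "g (f i) = c i" if "i < n" for i using that inj by (simp add: g_def)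
  have "(\<Sum>i<n. c i *\<^sub>R char_vector (f i)) = (\<Sum>C\<in>f ` {..<n}. g C *\<^sub>R char_vector C)"
    using gf by (simp add: sum.reindex[OF inj])
  also have "\<dots> = (\<Sum>C\<in>edge_classes P. g C *\<^sub>R char_vector C)"
    using fc(1) finite_K by (intro sum.mono_neutral_left) (auto simp: g_def)
  finally have comb: "(\<Sum>C\<in>edge_classes P. g C *\<^sub>R char_vector C) = char_vector (edges P)" using eq by simp
  have g1: "g C = 1" if C: "C \<in> edge_classes P" for C
  proof -
    obtain e where e: "e \<in> C" using class_nonempty[OF C] by blast
    then have "e \<in> edges P" using class_subset[OF C] by blast
    then show ?thesis
      using arg_cong[OF comb, of "\<lambda>v. Poly_Mapping.lookup v e"] lookup_combination[OF C e, of g]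
        lookup_char_vector[OF finite_E, of e] by simp
  qed
  have "bij_betw f {..<n} (edge_classes P)"
    unfolding bij_betw_def
  proof (intro conjI inj equalityI subsetI)
    fix C assume "C \<in> edge_classes P"
    then have "g C \<noteq> 0" using g1 by simp
    then show "C \<in> f ` {..<n}" by (auto simp: g_def split: if_splits)
  qed (use fc(1) in auto)
  moreover have "\<exists>t. R i = (+) t ` PC (f i)" if i: "i < n" for i
  proof -
    have "c i = 1" using g1[OF fc(1)[OF i]] gf[OF i] by simp
    moreover obtain s where "R i = (\<lambda>x. c i *\<^sub>R x + s) ` PC (f i)" using homothetic[OF i] by blast
    ultimately have "R i = (+) s ` PC (f i)" by (simp add: add.commute)
    then show ?thesis by blast
  qed
  ultimately show ?thesis by blast
qed

end

theorem corollary4p2p6: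
  fixes P :: "'a::euclidean_space set"
  assumes "polytope P" and "P \<noteq> {}"
    and "\<And>F. F face_of P \<Longrightarrow> aff_dim F = 2 \<Longrightarrow> 2 simplex F \<or> parallelogram F"
  shows "edge_decomposable P \<and> uniquely_decomposable P \<and>
    simplicial_cone (deformation_cone P) \<and>
    dim (deformation_cone P) = card (edge_classes P) \<and>
    (\<forall>C\<in>edge_classes P. \<exists>Q. class_deformation P C Q) \<and>
    rays (deformation_cone P) = (\<lambda>C. convex_cone hull {char_vector C}) ` edge_classes P \<and>
    (\<forall>PC. (\<forall>C\<in>edge_classes P. class_deformation P C (PC C)) \<longrightarrow>
       indecomposable_decomposition P (edge_classes P) PC \<and>
       (\<forall>n R. indecomposable_decomposition P {..<n::nat} R \<longrightarrow>
          (\<exists>f. bij_betw f {..<n} (edge_classes P) \<and>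
               (\<forall>i<n. \<exists>t. R i = (+) t ` PC (f i)))))"
proof -
  interpret triangle_parallelogram_polytope P
    using assms by unfold_locales
  show ?thesis
    unfolding uniquely_decomposable_def deformation_cone_eq
    using edge_decomposable simplicial_constant_cone dim_constant_cone class_deformation_exists
      rays_constant_cone class_decomposition decomposition_unique
    by (intro conjI allI impI ballI) auto
qed

end
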